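(* Let $p$ be a prime, $n\ge 2$, $D=p^n$, and let $|S\rangle$ be a pure stabilizer state of $N$ qudits of dimension $D$ whose qudits are partitioned into $m$ subsystems (parties) $\alpha=1,\dots,m$. Let $g^{(1)},\dots,g^{(\mathcal N)}$ be a generating set of $S$ and let $M_1,\dots,M_m\in\mathbb{Z}_{p^n}^{\mathcal N\times\mathcal N}$ be the corresponding subsystem phase matrices. Suppose $M_\alpha\equiv 0\pmod p$ for every $\alpha$. Then there exist Clifford unitaries $U_\alpha$, each acting only on the qudits of subsystem $\alpha$, such that \[ \Big(\bigotimes_\alpha U_\alpha\Big)|S\rangle=|S'\rangle_{p^{n-1}}\otimes|0\rangle_p^{\otimes N}, \] where each $D$-level qudit is identified with a $p^{n-1}$-level qudit tensored with a $p$-level qudit via $|pk+l\rangle\leftrightarrow|k\rangle\otimes|l\rangle$ ($0\le k<p^{n-1}$, $0\le l<p$), $|0\rangle_p^{\otimes N}$ denotes the $N$ $p$-level factors all in state $|0\rangle$, and $|S'\rangle_{p^{n-1}}$ is a pure stabilizer state of $N$ qudits of dimension $p^{n-1}$.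
   Context: Let $\omega=e^{2\pi i/D}$. On $\mathbb{C}^D$ let $X=\sum_j|j+1\rangle\langle j|$, $Z=\sum_j\omega^j|j\rangle\langle j|$ (indices mod $D$). The $N$-qudit Pauli group consists of operators $\omega^\gamma\prod_i X_i^{x_i}Z_i^{z_i}$ with $x_i,z_i\in\mathbb{Z}_D$, $\gamma$ an integer (integer or half-integer if $D$ even); a Clifford unitary is a unitary mapping the Pauli group to itself under conjugation. A stabilizer group is an abelian subgroup $S$ of the Pauli group whose only element proportional to the identity is the identity; if $|S|=D^N$ it stabilizes a unique state $|S\rangle$ ($|S\rangle\langle S|=D^{-N}\sum_{s\in S}s$), a pure stabilizer state. For a Pauli operator $g$ and subsystem $\alpha$, let $g_\alpha$ denote its tensor factor acting on the qudits of $\alpha$ (so $g=\prod_\alpha g_\alpha$). Subsystem phase matrices: given generators $g^{(1)},\dots,g^{(\mathcal N)}$ of $S$, $M_{\alpha}\in\mathbb{Z}_{D}^{\mathcal N\times\mathcal N}$ is defined by $g^{(j)}_\alpha g^{(i)}_\alpha=\omega^{M_{\alpha,ij}}g^{(i)}_\alpha g^{(j)}_\alpha$; equivalently, if $g^{(i)}\propto\prod_k X_k^{x^{(i)}_k}Z_k^{z^{(i)}_k}$, then $M_{\alpha,ij}=\sum_{k\in\alpha}\big(x^{(i)}_kz^{(j)}_k-z^{(i)}_kx^{(j)}_k\big)$. *)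

theory Defs
  imports Complex_Main "HOL-Computational_Algebra.Primes"
begin

text \<open>Multi-qudit states and operators. A computational basis index of the qudits
in a finite set Q of qudit labels, each of dimension D, is a function j with
j i < D for i in Q and j i = 0 outside Q. Vectors are functions on indices,
operators are matrices indexed by pairs of indices (zero off the basis).\<close>

type_synonym idx = "nat \<Rightarrow> nat"
type_synonym qop = "idx \<Rightarrow> idx \<Rightarrow> complex"
type_synonym qvec = "idx \<Rightarrow> complex"

definition basis :: "nat \<Rightarrow> nat set \<Rightarrow> idx set" where
  "basis D Q = {j. (\<forall>i\<in>Q. j i < D) \<and> (\<forall>i. i \<notin> Q \<longrightarrow> j i = 0)}"

definition op_mult :: "nat \<Rightarrow> nat set \<Rightarrow> qop \<Rightarrow> qop \<Rightarrow> qop" where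
  "op_mult D Q A B = (\<lambda>k j. \<Sum>l\<in>basis D Q. A k l * B l j)"

definition op_id :: "nat \<Rightarrow> nat set \<Rightarrow> qop" where
  "op_id D Q = (\<lambda>k j. if k \<in> basis D Q \<and> j = k then 1 else 0)"

definition op_adj :: "qop \<Rightarrow> qop" where
  "op_adj A = (\<lambda>k j. cnj (A j k))"

definition op_scale :: "complex \<Rightarrow> qop \<Rightarrow> qop" where
  "op_scale c A = (\<lambda>k j. c * A k j)"

definition apply_op :: "nat \<Rightarrow> nat set \<Rightarrow> qop \<Rightarrow> qvec \<Rightarrow> qvec" where
  "apply_op D Q A v = (\<lambda>k. \<Sum>j\<in>basis D Q. A k j * v j)"

definition omega :: "nat \<Rightarrow> complex" where
  "omega D = cis (2 * pi / real D)"

text \<open>The Pauli operator c * prod_i X_i^(x_i) Z_i^(z_i):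
 it maps |j> to c * omega^(sum_i z_i j_i) |j + x mod D>.\<close>
definition pauli_op :: "nat \<Rightarrow> nat set \<Rightarrow> complex \<Rightarrow> idx \<Rightarrow> idx \<Rightarrow> qop" where
  "pauli_op D Q c x z = (\<lambda>k j.
     if k \<in> basis D Q \<and> j \<in> basis D Q \<and> (\<forall>i\<in>Q. k i = (j i + x i) mod D)
     then c * omega D ^ (\<Sum>i\<in>Q. z i * j i) else 0)"

definition pauli_phases :: "nat \<Rightarrow> complex set" where
  "pauli_phases D = {cis (2 * pi * \<gamma> / real D) | \<gamma>::real.
       \<gamma> \<in> \<int> \<or> (even D \<and> 2 * \<gamma> \<in> \<int>)}"

definition pauli_group :: "nat \<Rightarrow> nat set \<Rightarrow> qop set" where
  "pauli_group D Q = {pauli_op D Q c x z | c x z.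
       c \<in> pauli_phases D \<and> (\<forall>i\<in>Q. x i < D \<and> z i < D)}"

definition unitary_op :: "nat \<Rightarrow> nat set \<Rightarrow> qop \<Rightarrow> bool" where
  "unitary_op D Q U \<longleftrightarrow>
     (\<forall>k j. U k j \<noteq> 0 \<longrightarrow> k \<in> basis D Q \<and> j \<in> basis D Q) \<and>
     op_mult D Q U (op_adj U) = op_id D Q \<and> op_mult D Q (op_adj U) U = op_id D Q"

definition clifford :: "nat \<Rightarrow> nat set \<Rightarrow> qop \<Rightarrow> bool" where
  "clifford D Q U \<longleftrightarrow> unitary_op D Q U \<and>
     (\<forall>P\<in>pauli_group D Q. op_mult D Q (op_mult D Q U P) (op_adj U) \<in> pauli_group D Q)"

definition stabilizer_group :: "nat \<Rightarrow> nat set \<Rightarrow> qop set \<Rightarrow> bool" where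
  "stabilizer_group D Q S \<longleftrightarrow>
     S \<subseteq> pauli_group D Q \<and> op_id D Q \<in> S \<and>
     (\<forall>a\<in>S. \<forall>b\<in>S. op_mult D Q a b \<in> S) \<and>
     (\<forall>a\<in>S. \<exists>b\<in>S. op_mult D Q a b = op_id D Q) \<and>
     (\<forall>a\<in>S. \<forall>b\<in>S. op_mult D Q a b = op_mult D Q b a) \<and>
     (\<forall>s\<in>S. (\<exists>c. s = op_scale c (op_id D Q)) \<longrightarrow> s = op_id D Q)"

definition pure_stabilizer_group :: "nat \<Rightarrow> nat set \<Rightarrow> qop set \<Rightarrow> bool" where
  "pure_stabilizer_group D Q S \<longleftrightarrow>
     stabilizer_group D Q S \<and> finite S \<and> card S = D ^ card Q"

text \<open>psi is (a unit vector representing) the stabilizer state |S>: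
  |psi><psi| = D^(-|Q|) * sum of the elements of S.\<close>
definition is_stabilizer_state :: "nat \<Rightarrow> nat set \<Rightarrow> qop set \<Rightarrow> qvec \<Rightarrow> bool" where
  "is_stabilizer_state D Q S \<psi> \<longleftrightarrow>
     (\<forall>k\<in>basis D Q. \<forall>j\<in>basis D Q.
        \<psi> k * cnj (\<psi> j) = (\<Sum>s\<in>S. s k j) / of_nat D ^ card Q)"

inductive_set generated :: "nat \<Rightarrow> nat set \<Rightarrow> qop set \<Rightarrow> qop set"
  for D Q G where
  gen_id: "op_id D Q \<in> generated D Q G"
| gen_mult: "g \<in> G \<Longrightarrow> s \<in> generated D Q G \<Longrightarrow> op_mult D Q g s \<in> generated D Q G"

definition restrict_idx :: "nat set \<Rightarrow> idx \<Rightarrow> idx" where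
  "restrict_idx A k = (\<lambda>i. if i \<in> A then k i else 0)"

text \<open>Tensor product of operators U alpha, each acting on the qudits part alpha
  (alpha < m), the parts partitioning Q.\<close>
definition local_tensor :: "nat \<Rightarrow> nat set \<Rightarrow> nat \<Rightarrow> (nat \<Rightarrow> nat set) \<Rightarrow> (nat \<Rightarrow> qop) \<Rightarrow> qop" where
  "local_tensor D Q m part U = (\<lambda>k j.
     if k \<in> basis D Q \<and> j \<in> basis D Q
     then \<Prod>\<alpha><m. U \<alpha> (restrict_idx (part \<alpha>) k) (restrict_idx (part \<alpha>) j)
     else 0)"

end

(* Modulo p, the hypothesis says that on every party the exponent vectors of the generators
   are pairwise symplectically orthogonal. An isotropic family over the field with p elements
   is moved to vectors with vanishing X-part by a symplectic map that is a product of phase,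
   controlled-phase and Fourier gates, so local Cliffords make all X-exponents of the
   stabilizer group divisible by p. The matrix of such a Pauli operator only connects basis
   states that agree modulo p, and the projector onto the state has rank one; hence the state
   is supported on a single residue class, which a Pauli shift moves to 0. Restricting the
   group to this class gives Pauli operators of dimension D/p; comparing traces shows that
   the restriction has kernel of order p^N, so the image is again a maximal stabilizer group. *)

theory Submission
  imports Defs "HOL-Number_Theory.Cong" "HOL-Library.FuncSet"
begin

section \<open>Roots of unity and Pauli phases\<close>

text \<open>Two moduli interact: Pauli operators see exponents modulo \<open>D\<close>, the
  hypothesis sees them modulo \<open>p\<close>. The gates are Cliffords of dimension
  \<open>D\<close>, but the elimination takes place over the residue field, where an X-exponent
  prime to \<open>p\<close> is invertible. It runs over the qudits of a party, with any vector that
  has an invertible X-exponent there as pivot, so a redundant generating family is handled like an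
  independent one.

  The obstacle is the phases. The scalar of a restricted operator comes from dimension
  \<open>D\<close>, and fewer roots of unity are allowed in dimension \<open>D / p\<close>. Scalars
  are therefore not tracked. A Pauli operator raised to the power of its dimension is a scalar, and
  in a group whose only scalar is the identity this scalar is 1, which pins the phase to the right
  roots of unity.

  Exponents are natural numbers and mostly stay unreduced; \<open>D - 1\<close> stands for
  -1.\<close>

lemma omega_power_cong:
  assumes "[a = b] (mod D)"
  shows "omega D ^ a = omega D ^ b"
proof (cases "D = 0")
  case True
  then show ?thesis using assms by (simp add: cong_def)
next
  case False
  have one: "omega D ^ D = 1"
    using False by (simp add: omega_def DeMoivre)
  have red: "omega D ^ c = omega D ^ (c mod D)" for c
  proof -
    have "omega D ^ c = omega D ^ (D * (c div D) + c mod D)" by simp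
    also have "\<dots> = omega D ^ (c mod D)"
      by (simp only: power_add power_mult one power_one mult_1_left)
    finally show ?thesis .
  qed
  show ?thesis
    using red[of a] red[of b] assms by (simp add: cong_def)
qed

lemma norm_omega [simp]: "norm (omega D) = 1"
  by (simp add: omega_def)

lemma cnj_omega_power: "omega D ^ a * cnj (omega D ^ a) = 1"
  by (simp add: complex_norm_square[symmetric] norm_power flip: complex_cnj_power)

lemma omega_power_eq_1_iff:
  assumes "D > 0"
  shows "omega D ^ a = 1 \<longleftrightarrow> D dvd a"
proof
  assume "omega D ^ a = 1"
  then have "omega D ^ (a mod D) = 1"
    using omega_power_cong[of a "a mod D" D] by (simp add: cong_def)
  moreover have "omega D ^ k = cis (2 * pi * real k / real D)" for k
    by (simp add: omega_def DeMoivre mult_ac)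
  ultimately have "cis (2 * pi * real (a mod D) / real D) = cis (2 * pi * real 0 / real D)"
    by simp
  then have "a mod D = 0"
    using bij_betw_roots_unity[OF assms] assms unfolding bij_betw_def inj_on_def by force
  then show "D dvd a" by auto
next
  assume "D dvd a"
  then show "omega D ^ a = 1"
    using omega_power_cong[of a 0 D] by (simp add: cong_def)
qed

text \<open>The order of the phase group: half-integer powers of omega are roots of unity of order
  \<open>2 * D\<close>. The condition \<open>c ^ phase_order D = 1\<close> makes closure under
  products immediate.\<close>

definition phase_order :: "nat \<Rightarrow> nat" where
  "phase_order D = (if even D then 2 * D else D)"

lemma pauli_phases_eq:
  assumes "D > 0"
  shows "pauli_phases D = {c. c ^ phase_order D = 1}"
proof (intro set_eqI iffI)
  fix c assume "c \<in> pauli_phases D"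
  then obtain \<gamma> where c: "c = cis (2 * pi * \<gamma> / real D)"
    and \<gamma>: "\<gamma> \<in> \<int> \<or> (even D \<and> 2 * \<gamma> \<in> \<int>)"
    unfolding pauli_phases_def by blast
  have eq: "cis (2 * pi * \<gamma> / real D) ^ k = cis (2 * pi * (real k * \<gamma> / real D))" for k
    by (simp add: DeMoivre field_simps)
  have "real (phase_order D) * \<gamma> / real D \<in> \<int>"
    using \<gamma> assms by (auto simp: phase_order_def)
  then show "c \<in> {c. c ^ phase_order D = 1}"
    using cis_multiple_2pi by (simp only: c eq mem_Collect_eq)
next
  fix c :: complex assume c: "c \<in> {c. c ^ phase_order D = 1}"
  have "phase_order D > 0" using assms by (simp add: phase_order_def)
  then obtain k where k: "c = cis (2 * pi * real k / real (phase_order D))"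
    using bij_betw_roots_unity[of "phase_order D"] c unfolding bij_betw_def by blast
  show "c \<in> pauli_phases D"
    unfolding pauli_phases_def mem_Collect_eq k
    by (rule exI[of _ "if even D then real k / 2 else real k"])
       (auto simp: phase_order_def)
qed

lemma pauli_phases_mult:
  "D > 0 \<Longrightarrow> a \<in> pauli_phases D \<Longrightarrow> b \<in> pauli_phases D \<Longrightarrow> a * b \<in> pauli_phases D"
  by (simp add: pauli_phases_eq power_mult_distrib)

lemma pauli_phases_1: "D > 0 \<Longrightarrow> 1 \<in> pauli_phases D"
  by (simp add: pauli_phases_eq)

lemma pauli_phases_power:
  "D > 0 \<Longrightarrow> a \<in> pauli_phases D \<Longrightarrow> a ^ k \<in> pauli_phases D"
  by (induction k) (simp_all add: pauli_phases_1 pauli_phases_mult)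

lemma omega_in_phases: "D > 0 \<Longrightarrow> omega D \<in> pauli_phases D"
  using omega_power_eq_1_iff[of D "phase_order D"]
  by (simp add: pauli_phases_eq phase_order_def)

text \<open>The square root of omega is chosen so that its power at \<open>j ^ 2\<close> depends on \<open>j\<close> modulo \<open>D\<close> only.\<close>

lemma omega_square_root:
  assumes "D > 0"
  obtains s where "s ^ 2 = omega D" "s ^ (D ^ 2) = 1" "s \<in> pauli_phases D"
proof (cases "even D")
  case True
  then obtain d where d: "D = 2 * d" by blast
  \<comment> \<open>For even \<open>D\<close> this root satisfies \<open>s ^ (2 * D) = 1\<close>,
    and \<open>D ^ 2\<close> is \<open>d\<close> times \<open>2 * D\<close>.\<close>
  define s where "s = cis (pi / real D)"
  have 1: "s ^ 2 = omega D" by (simp add: s_def omega_def DeMoivre)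
  have "omega D ^ D = 1" using omega_power_eq_1_iff[OF assms] by simp
  then have 2: "s ^ (2 * D) = 1" unfolding power_mult 1 .
  have "s ^ (D ^ 2) = (s ^ (2 * D)) ^ d"
    by (simp add: d power2_eq_square mult_ac flip: power_mult)
  then show ?thesis
    using that[of s] 1 2 True by (simp add: pauli_phases_eq[OF assms] phase_order_def)
next
  case False
  then obtain d where d: "D = 2 * d + 1" by (blast elim: oddE)
  \<comment> \<open>\<open>d + 1\<close> is the inverse of 2 modulo the odd number \<open>D\<close>,
    so the square root is itself a power of \<open>omega D\<close>.\<close>
  define s where "s = omega D ^ (d + 1)"
  have "s ^ 2 = omega D ^ (2 * (d + 1))" by (simp only: s_def power_mult[symmetric] mult.commute)
  also have "2 * (d + 1) = D + 1" by (simp add: d)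
  also have "omega D ^ (D + 1) = omega D ^ 1"
    by (rule omega_power_cong) (simp only: cong_def mod_add_self1)
  finally have 1: "s ^ 2 = omega D" by simp
  have 2: "s ^ D = 1"
    unfolding s_def power_mult[symmetric] by (simp add: omega_power_eq_1_iff[OF assms])
  then have "s ^ (D ^ 2) = 1" by (simp add: power2_eq_square power_mult)
  then show ?thesis
    using that[of s] 1 2 False by (simp add: pauli_phases_eq[OF assms] phase_order_def)
qed

section \<open>Operators and Pauli operators\<close>

lemma finite_basis: "finite Q \<Longrightarrow> finite (basis D Q)"
proof -
  assume Q: "finite Q"
  have "basis D Q \<subseteq> (\<lambda>f i. if i \<in> Q then f i else 0) ` (Q \<rightarrow>\<^sub>E {..<D})"
  proof
    fix j assume j: "j \<in> basis D Q"
    then have "j = (\<lambda>i. if i \<in> Q then restrict j Q i else 0)"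
      by (auto simp: basis_def fun_eq_iff)
    moreover have "restrict j Q \<in> Q \<rightarrow>\<^sub>E {..<D}"
      using j by (auto simp: basis_def)
    ultimately show "j \<in> (\<lambda>f i. if i \<in> Q then f i else 0) ` (Q \<rightarrow>\<^sub>E {..<D})"
      by blast
  qed
  then show ?thesis
    by (rule finite_subset) (intro finite_imageI finite_PiE Q; simp)
qed

text \<open>Operators are total functions on index pairs. Equality on the basis becomes equality of
  functions only for operators that vanish elsewhere; \<open>op_ext\<close> and the unit laws rest
  on this.\<close>

definition supported :: "nat \<Rightarrow> nat set \<Rightarrow> qop \<Rightarrow> bool" where
  "supported D Q A \<longleftrightarrow> (\<forall>k j. A k j \<noteq> 0 \<longrightarrow> k \<in> basis D Q \<and> j \<in> basis D Q)"

lemma supportedD: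
  "supported D Q A \<Longrightarrow> k \<notin> basis D Q \<Longrightarrow> A k j = 0"
  "supported D Q A \<Longrightarrow> j \<notin> basis D Q \<Longrightarrow> A k j = 0"
  by (auto simp: supported_def)

lemma supported_op_mult:
  assumes "supported D Q A" "supported D Q B"
  shows "supported D Q (op_mult D Q A B)"
  unfolding supported_def op_mult_def
proof (intro allI impI)
  fix k j assume "(\<Sum>l\<in>basis D Q. A k l * B l j) \<noteq> 0"
  then obtain l where "A k l * B l j \<noteq> 0" by (meson sum.neutral)
  then show "k \<in> basis D Q \<and> j \<in> basis D Q"
    using assms by (auto simp: supported_def)
qed

lemma supported_op_adj: "supported D Q A \<Longrightarrow> supported D Q (op_adj A)"
  by (auto simp: supported_def op_adj_def)

lemma supported_op_id: "supported D Q (op_id D Q)"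
  by (auto simp: supported_def op_id_def)

lemma supported_pauli_op: "supported D Q (pauli_op D Q c x z)"
  by (auto simp: supported_def pauli_op_def split: if_splits)

lemma supported_unitary: "unitary_op D Q U \<Longrightarrow> supported D Q U"
  by (auto simp: supported_def unitary_op_def)

lemma op_ext:
  assumes "supported D Q A" "supported D Q B"
    and "\<And>k j. k \<in> basis D Q \<Longrightarrow> j \<in> basis D Q \<Longrightarrow> A k j = B k j"
  shows "A = B"
proof (intro ext)
  fix k j
  show "A k j = B k j"
    using assms(3)[of k j] supportedD[OF assms(1)] supportedD[OF assms(2)]
    by (cases "k \<in> basis D Q \<and> j \<in> basis D Q") auto
qed

lemma op_mult_assoc:
  "op_mult D Q (op_mult D Q A B) C = op_mult D Q A (op_mult D Q B C)"
proof (intro ext)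
  fix k j
  have "(\<Sum>l\<in>basis D Q. (\<Sum>i\<in>basis D Q. A k i * B i l) * C l j) =
        (\<Sum>l\<in>basis D Q. \<Sum>i\<in>basis D Q. A k i * B i l * C l j)"
    by (simp add: sum_distrib_right)
  also have "\<dots> = (\<Sum>i\<in>basis D Q. \<Sum>l\<in>basis D Q. A k i * B i l * C l j)"
    by (rule sum.swap)
  also have "\<dots> = (\<Sum>i\<in>basis D Q. A k i * (\<Sum>l\<in>basis D Q. B i l * C l j))"
    by (simp add: sum_distrib_left mult.assoc)
  finally show "op_mult D Q (op_mult D Q A B) C k j = op_mult D Q A (op_mult D Q B C) k j"
    by (simp add: op_mult_def)
qed

lemma op_adj_mult: "op_adj (op_mult D Q A B) = op_mult D Q (op_adj B) (op_adj A)"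
  by (simp add: op_adj_def op_mult_def fun_eq_iff mult.commute)

lemma op_adj_adj: "op_adj (op_adj A) = A"
  by (simp add: op_adj_def)

lemma op_scale_mult_left: "op_mult D Q (op_scale c A) B = op_scale c (op_mult D Q A B)"
  by (simp add: op_mult_def op_scale_def fun_eq_iff sum_distrib_left mult_ac)

lemma op_scale_mult_right: "op_mult D Q A (op_scale c B) = op_scale c (op_mult D Q A B)"
  by (simp add: op_mult_def op_scale_def fun_eq_iff sum_distrib_left mult_ac)

lemma op_scale_1: "op_scale 1 A = A"
  by (simp add: op_scale_def)

lemma op_mult_id_left:
  assumes "finite Q" "supported D Q A"
  shows "op_mult D Q (op_id D Q) A = A"
proof (intro ext)
  fix k j
  have "(\<Sum>l\<in>basis D Q. op_id D Q k l * A l j) = (\<Sum>l\<in>basis D Q. if l = k then A k j else 0)"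
    by (intro sum.cong) (auto simp: op_id_def)
  then show "op_mult D Q (op_id D Q) A k j = A k j"
    using supportedD(1)[OF assms(2), of k j]
    by (simp add: op_mult_def finite_basis assms(1))
qed

lemma op_mult_id_right:
  assumes "finite Q" "supported D Q A"
  shows "op_mult D Q A (op_id D Q) = A"
proof (intro ext)
  fix k j
  have "(\<Sum>l\<in>basis D Q. A k l * op_id D Q l j) = (\<Sum>l\<in>basis D Q. if l = j then A k j else 0)"
    by (intro sum.cong) (auto simp: op_id_def)
  then show "op_mult D Q A (op_id D Q) k j = A k j"
    using supportedD(2)[OF assms(2), of j k]
    by (simp add: op_mult_def finite_basis assms(1))
qed

lemma unitary_op_mult:
  assumes Q: "finite Q" and U: "unitary_op D Q U" and V: "unitary_op D Q V"
  shows "unitary_op D Q (op_mult D Q U V)"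
proof -
  let ?m = "op_mult D Q"
  note sU = supported_unitary[OF U] and sV = supported_unitary[OF V]
  have "?m (?m U V) (?m (op_adj V) (op_adj U)) = ?m U (?m (?m V (op_adj V)) (op_adj U))"
    by (simp only: op_mult_assoc)
  also have "\<dots> = op_id D Q"
    using U V by (simp add: unitary_op_def op_mult_id_left[OF Q supported_op_adj[OF sU]])
  finally have 1: "?m (?m U V) (?m (op_adj V) (op_adj U)) = op_id D Q" .
  have "?m (?m (op_adj V) (op_adj U)) (?m U V) = ?m (op_adj V) (?m (?m (op_adj U) U) V)"
    by (simp only: op_mult_assoc)
  also have "\<dots> = op_id D Q"
    using U V by (simp add: unitary_op_def op_mult_id_left[OF Q sV])
  finally have 2: "?m (?m (op_adj V) (op_adj U)) (?m U V) = op_id D Q" .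
  show ?thesis
    using 1 2 supported_op_mult[OF sU sV] by (simp add: unitary_op_def op_adj_mult supported_def)
qed

section \<open>Translations of basis indices and Pauli operators as weighted permutations\<close>

definition shift :: "nat \<Rightarrow> nat set \<Rightarrow> idx \<Rightarrow> idx \<Rightarrow> idx" where
  "shift D Q x k = (\<lambda>i. if i \<in> Q then (k i + x i) mod D else 0)"

lemma shift_basis: "D > 0 \<Longrightarrow> shift D Q x k \<in> basis D Q"
  by (auto simp: shift_def basis_def)

lemma shift_shift: "shift D Q x (shift D Q y k) = shift D Q (\<lambda>i. x i + y i) k"
  by (auto simp: shift_def fun_eq_iff mod_simps ac_simps)

lemma shift_eq_self:
  assumes "\<And>i. i \<in> Q \<Longrightarrow> D dvd x i" "k \<in> basis D Q"
  shows "shift D Q x k = k"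
proof
  fix i
  show "shift D Q x k i = k i"
    using assms(1)[of i] assms(2) by (auto simp: shift_def basis_def elim!: dvdE)
qed

text \<open>Translation by -x is written with the exponent \<open>x i * (D - 1)\<close>, because x +
  x (D - 1) = D x.\<close>

lemma shift_inverse:
  assumes "D > 0" "k \<in> basis D Q"
  shows "shift D Q x (shift D Q (\<lambda>i. x i * (D - 1)) k) = k"
  unfolding shift_shift
proof (rule shift_eq_self[OF _ assms(2)])
  fix i
  have "x i + x i * (D - 1) = D * x i"
    using assms(1) by (cases D) auto
  then show "D dvd x i + x i * (D - 1)" by simp
qed

lemma bij_betw_shift:
  assumes "D > 0"
  shows "bij_betw (shift D Q x) (basis D Q) (basis D Q)"
proof (rule bij_betwI[where g = "shift D Q (\<lambda>i. x i * (D - 1))"])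
  fix k assume "k \<in> basis D Q"
  show "shift D Q (\<lambda>i. x i * (D - 1)) (shift D Q x k) = k"
    using shift_inverse[OF assms \<open>k \<in> _\<close>, of x] by (simp add: shift_shift add.commute)
qed (use shift_basis[OF assms] shift_inverse[OF assms] in auto)

lemma pauli_op_eq:
  assumes "D > 0"
  shows "pauli_op D Q c x z k j =
    (if j \<in> basis D Q \<and> k = shift D Q x j then c * omega D ^ (\<Sum>i\<in>Q. z i * j i) else 0)"
proof -
  have "k \<in> basis D Q \<and> (\<forall>i\<in>Q. k i = (j i + x i) mod D) \<longleftrightarrow> k = shift D Q x j"
    using assms by (auto simp: basis_def shift_def fun_eq_iff)
  then show ?thesis by (auto simp: pauli_op_def)
qed

lemma pauli_op_scale: "pauli_op D Q c x z = op_scale c (pauli_op D Q 1 x z)"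
  by (auto simp: pauli_op_def op_scale_def fun_eq_iff)

lemma omega_sum_cong:
  assumes "\<And>i. i \<in> Q \<Longrightarrow> [a i = b i] (mod D)"
  shows "omega D ^ (\<Sum>i\<in>Q. a i) = omega D ^ (\<Sum>i\<in>Q. b i)"
  by (rule omega_power_cong, rule cong_sum) (use assms in auto)

text \<open>This is what permits unreduced exponents: products simply add them, and
  \<open>mod\<close> returns only for membership in \<open>pauli_group\<close>.\<close>

lemma pauli_op_cong:
  assumes D: "D > 0" and x: "\<And>i. i \<in> Q \<Longrightarrow> [x i = x' i] (mod D)"
    and z: "\<And>i. i \<in> Q \<Longrightarrow> [z i = z' i] (mod D)"
  shows "pauli_op D Q c x z = pauli_op D Q c x' z'"
proof (intro ext)
  fix k j
  have "shift D Q x j = shift D Q x' j"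
    using x by (auto simp: shift_def fun_eq_iff cong_def intro: mod_add_cong)
  moreover have "omega D ^ (\<Sum>i\<in>Q. z i * j i) = omega D ^ (\<Sum>i\<in>Q. z' i * j i)"
    by (rule omega_sum_cong) (use z cong_mult[OF z cong_refl] in auto)
  ultimately show "pauli_op D Q c x z k j = pauli_op D Q c x' z' k j"
    by (simp add: pauli_op_eq[OF D])
qed

lemma pauli_op_in_group:
  assumes "D > 0" "c \<in> pauli_phases D"
  shows "pauli_op D Q c x z \<in> pauli_group D Q"
proof -
  have "pauli_op D Q c x z = pauli_op D Q c (\<lambda>i. x i mod D) (\<lambda>i. z i mod D)"
    by (rule pauli_op_cong) (use assms in \<open>auto simp: cong_def\<close>)
  then show ?thesis
    using assms unfolding pauli_group_def by fastforce
qed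

lemma op_mult_pauli:
  assumes "D > 0" "finite Q" "j \<in> basis D Q"
  shows "op_mult D Q A (pauli_op D Q c x z) k j =
    A k (shift D Q x j) * (c * omega D ^ (\<Sum>i\<in>Q. z i * j i))"
proof -
  have "op_mult D Q A (pauli_op D Q c x z) k j =
    (\<Sum>l\<in>basis D Q. if l = shift D Q x j
       then A k (shift D Q x j) * (c * omega D ^ (\<Sum>i\<in>Q. z i * j i)) else 0)"
    unfolding op_mult_def by (intro sum.cong) (auto simp: pauli_op_eq assms)
  then show ?thesis
    by (simp add: finite_basis assms shift_basis)
qed

text \<open>Every row index is a translate \<open>shift D Q x k\<close>. Writing it so identifies
  the single nonzero entry of the row without an inverse translation.\<close>

lemma pauli_op_mult:
  assumes "D > 0" "finite Q" "k \<in> basis D Q"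
  shows "op_mult D Q (pauli_op D Q c x z) A (shift D Q x k) j =
    c * omega D ^ (\<Sum>i\<in>Q. z i * k i) * A k j"
proof -
  have inj: "shift D Q x k = shift D Q x l \<longleftrightarrow> l = k" if "l \<in> basis D Q" for l
    using bij_betw_shift[OF assms(1), of Q x] that assms(3)
    by (auto simp: bij_betw_def inj_on_def)
  have "op_mult D Q (pauli_op D Q c x z) A (shift D Q x k) j =
    (\<Sum>l\<in>basis D Q. if l = k then c * omega D ^ (\<Sum>i\<in>Q. z i * k i) * A k j else 0)"
    unfolding op_mult_def by (intro sum.cong) (auto simp: pauli_op_eq assms inj)
  then show ?thesis
    by (simp add: finite_basis assms)
qed

text \<open>The extra phase arises from moving the Z-part of the first factor past the X-part of the
  second.\<close>

lemma pauli_op_product: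
  assumes "D > 0" "finite Q"
  shows "op_mult D Q (pauli_op D Q c x z) (pauli_op D Q c' x' z') =
    pauli_op D Q (c * c' * omega D ^ (\<Sum>i\<in>Q. z i * x' i)) (\<lambda>i. x i + x' i) (\<lambda>i. z i + z' i)"
proof (rule op_ext[of D Q])
  fix k j assume kj: "k \<in> basis D Q" "j \<in> basis D Q"
  have "omega D ^ (\<Sum>i\<in>Q. z i * shift D Q x' j i) = omega D ^ (\<Sum>i\<in>Q. z i * (j i + x' i))"
    by (rule omega_sum_cong) (simp add: shift_def cong_def mod_simps)
  then show "op_mult D Q (pauli_op D Q c x z) (pauli_op D Q c' x' z') k j =
    pauli_op D Q (c * c' * omega D ^ (\<Sum>i\<in>Q. z i * x' i)) (\<lambda>i. x i + x' i) (\<lambda>i. z i + z' i) k j"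
    using kj assms
    by (simp add: op_mult_pauli pauli_op_eq shift_basis shift_shift algebra_simps
        sum.distrib power_add)
qed (simp_all add: supported_pauli_op supported_op_mult)

text \<open>With rows written as translates, both products collapse to one entry of
  \<open>U\<close>. A conjugation relation is thus one scalar identity, and the adjoint of
  \<open>U\<close> never enters.\<close>

lemma pauli_op_intertwine:
  assumes D: "D > 0" and Q: "finite Q" and U: "supported D Q U"
    and eq: "\<And>k j. k \<in> basis D Q \<Longrightarrow> j \<in> basis D Q \<Longrightarrow>
      U (shift D Q x' k) (shift D Q x j) * (c * omega D ^ (\<Sum>i\<in>Q. z i * j i)) =
      c' * omega D ^ (\<Sum>i\<in>Q. z' i * k i) * U k j"
  shows "op_mult D Q U (pauli_op D Q c x z) = op_mult D Q (pauli_op D Q c' x' z') U"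
proof (rule op_ext[of D Q])
  fix k j assume kj: "k \<in> basis D Q" "j \<in> basis D Q"
  then obtain k' where k': "k' \<in> basis D Q" "k = shift D Q x' k'"
    using bij_betw_shift[OF D, of Q x'] by (auto simp: bij_betw_def)
  show "op_mult D Q U (pauli_op D Q c x z) k j = op_mult D Q (pauli_op D Q c' x' z') U k j"
    unfolding k'(2) op_mult_pauli[OF D Q kj(2)] pauli_op_mult[OF D Q k'(1)]
    by (rule eq[OF k'(1) kj(2)])
qed (simp_all add: supported_pauli_op supported_op_mult U)

lemma op_id_eq_pauli_op: "D > 0 \<Longrightarrow> op_id D Q = pauli_op D Q 1 (\<lambda>_. 0) (\<lambda>_. 0)"
  by (intro ext) (auto simp: op_id_def pauli_op_eq shift_eq_self)

lemma conj_eq_of_intertwine: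
  assumes "finite Q" "unitary_op D Q U" "supported D Q P'"
    and "op_mult D Q U P = op_mult D Q P' U"
  shows "op_mult D Q (op_mult D Q U P) (op_adj U) = P'"
  using assms by (simp add: op_mult_assoc unitary_op_def op_mult_id_right)

section \<open>Clifford unitaries and their action on Pauli exponents\<close>

text \<open>Conjugation in the form U P = P' U, which composes by associativity alone. The scalar
  stays existential: the divisibility arguments need only the exponents, and Cliffordness only that
  the scalar is an admissible phase.\<close>

definition clifford_map :: "nat \<Rightarrow> nat set \<Rightarrow> qop \<Rightarrow> (idx \<times> idx \<Rightarrow> idx \<times> idx) \<Rightarrow> bool" where
  "clifford_map D Q U f \<longleftrightarrow> unitary_op D Q U \<and>
     (\<forall>x z. \<exists>c\<in>pauli_phases D. op_mult D Q U (pauli_op D Q 1 x z) =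
        op_mult D Q (pauli_op D Q c (fst (f (x, z))) (snd (f (x, z)))) U)"

lemma clifford_mapE:
  assumes "clifford_map D Q U f"
  obtains c' where "c' \<in> pauli_phases D"
    "\<And>c. op_mult D Q U (pauli_op D Q c x z) =
      op_mult D Q (pauli_op D Q (c * c') (fst (f (x, z))) (snd (f (x, z)))) U"
proof -
  let ?P = "\<lambda>c. pauli_op D Q c (fst (f (x, z))) (snd (f (x, z)))"
  obtain c' where c': "c' \<in> pauli_phases D"
    "op_mult D Q U (pauli_op D Q 1 x z) = op_mult D Q (?P c') U"
    using assms unfolding clifford_map_def by blast
  have "op_mult D Q U (pauli_op D Q c x z) = op_mult D Q (?P (c * c')) U" for c
  proof -
    have "op_mult D Q U (pauli_op D Q c x z) = op_scale c (op_mult D Q U (pauli_op D Q 1 x z))"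
      by (simp add: pauli_op_scale[of _ _ c] op_scale_mult_right)
    also have "\<dots> = op_mult D Q (op_scale c (?P c')) U"
      by (simp add: c' op_scale_mult_left)
    also have "op_scale c (?P c') = ?P (c * c')"
      by (auto simp: op_scale_def pauli_op_def fun_eq_iff)
    finally show ?thesis .
  qed
  then show ?thesis using that c' by blast
qed

lemma clifford_map_imp_clifford:
  assumes D: "D > 0" and Q: "finite Q" and U: "clifford_map D Q U f"
  shows "clifford D Q U"
  unfolding clifford_def
proof (intro conjI ballI)
  show unitary: "unitary_op D Q U" using U by (simp add: clifford_map_def)
  fix P assume "P \<in> pauli_group D Q"
  then obtain c x z where P: "P = pauli_op D Q c x z" "c \<in> pauli_phases D"
    unfolding pauli_group_def by blast
  obtain c' where c': "c' \<in> pauli_phases D"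
    and eq: "op_mult D Q U P =
      op_mult D Q (pauli_op D Q (c * c') (fst (f (x, z))) (snd (f (x, z)))) U"
    using clifford_mapE[OF U, of x z] P(1) by metis
  show "op_mult D Q (op_mult D Q U P) (op_adj U) \<in> pauli_group D Q"
    unfolding conj_eq_of_intertwine[OF Q unitary supported_pauli_op eq]
    using D P(2) c' by (intro pauli_op_in_group pauli_phases_mult)
qed

lemma unitary_op_id: "finite Q \<Longrightarrow> unitary_op D Q (op_id D Q)"
proof -
  assume Q: "finite Q"
  have "op_adj (op_id D Q) = op_id D Q"
    by (intro ext) (auto simp: op_adj_def op_id_def)
  then show ?thesis
    using op_mult_id_left[OF Q supported_op_id, of D] supported_op_id[of D Q]
    by (simp add: unitary_op_def supported_def)
qed

lemma clifford_map_id: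
  assumes "D > 0" "finite Q"
  shows "clifford_map D Q (op_id D Q) id"
  using assms unfolding clifford_map_def
  by (auto intro!: bexI[of _ 1] simp: unitary_op_id op_mult_id_left op_mult_id_right
      supported_pauli_op pauli_phases_1)

lemma clifford_map_comp:
  assumes D: "D > 0" and Q: "finite Q"
    and U: "clifford_map D Q U f" and V: "clifford_map D Q V g"
  shows "clifford_map D Q (op_mult D Q U V) (f \<circ> g)"
  unfolding clifford_map_def
proof (intro conjI allI)
  show "unitary_op D Q (op_mult D Q U V)"
    using U V Q by (simp add: clifford_map_def unitary_op_mult)
  fix x z
  let ?m = "op_mult D Q"
  obtain x' z' where g: "g (x, z) = (x', z')" by fastforce
  obtain c where c: "c \<in> pauli_phases D"
    "\<And>a. ?m V (pauli_op D Q a x z) = ?m (pauli_op D Q (a * c) x' z') V"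
    using clifford_mapE[OF V, of x z] g by (metis fst_conv snd_conv)
  obtain c' where c': "c' \<in> pauli_phases D"
    "\<And>a. ?m U (pauli_op D Q a x' z') =
      ?m (pauli_op D Q (a * c') (fst (f (x', z'))) (snd (f (x', z')))) U"
    using clifford_mapE[OF U, of x' z'] by metis
  show "\<exists>c\<in>pauli_phases D. ?m (?m U V) (pauli_op D Q 1 x z) =
    ?m (pauli_op D Q c (fst ((f \<circ> g) (x, z))) (snd ((f \<circ> g) (x, z)))) (?m U V)"
  proof (rule bexI)
    have "?m (?m U V) (pauli_op D Q 1 x z) = ?m (?m U (pauli_op D Q c x' z')) V"
      by (simp add: op_mult_assoc c)
    also have "\<dots> = ?m (pauli_op D Q (c * c') (fst (f (x', z'))) (snd (f (x', z')))) (?m U V)"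
      by (simp add: op_mult_assoc c')
    finally show "?m (?m U V) (pauli_op D Q 1 x z) =
      ?m (pauli_op D Q (c * c') (fst ((f \<circ> g) (x, z))) (snd ((f \<circ> g) (x, z)))) (?m U V)"
      by (simp add: g)
  qed (use D c c' pauli_phases_mult in auto)
qed

text \<open>Paulis commute up to a phase, so conjugation by one leaves all exponents alone. The
  final translation of the state can therefore be added to a gate without disturbing what the gate
  achieved.\<close>

lemma clifford_map_pauli:
  assumes D: "D > 0" and Q: "finite Q"
  shows "clifford_map D Q (pauli_op D Q 1 x z) id"
  unfolding clifford_map_def
proof (intro conjI allI)
  let ?P = "pauli_op D Q 1 x z"
  show "unitary_op D Q ?P"
    unfolding unitary_op_def
  proof (intro conjI)
    show "\<forall>k j. ?P k j \<noteq> 0 \<longrightarrow> k \<in> basis D Q \<and> j \<in> basis D Q"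
      using supported_pauli_op by (simp add: supported_def)
    have inj: "shift D Q x k = shift D Q x l \<longleftrightarrow> l = k"
      if "l \<in> basis D Q" "k \<in> basis D Q" for l k
      using bij_betw_shift[OF D, of Q x] that by (auto simp: bij_betw_def inj_on_def)
    show "op_mult D Q (op_adj ?P) ?P = op_id D Q"
    proof (rule op_ext[of D Q])
      fix k j assume kj: "k \<in> basis D Q" "j \<in> basis D Q"
      show "op_mult D Q (op_adj ?P) ?P k j = op_id D Q k j"
        using kj inj[OF kj] cnj_omega_power
        by (auto simp: op_mult_pauli[OF D Q] op_adj_def pauli_op_eq[OF D] op_id_def mult.commute)
    qed (simp_all add: supported_op_mult supported_op_adj supported_pauli_op supported_op_id)
    show "op_mult D Q ?P (op_adj ?P) = op_id D Q"
    proof (rule op_ext[of D Q])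
      fix k j assume kj: "k \<in> basis D Q" "j \<in> basis D Q"
      obtain k' where k': "k' \<in> basis D Q" "k = shift D Q x k'"
        using bij_betw_shift[OF D, of Q x] kj(1) by (auto simp: bij_betw_def)
      show "op_mult D Q ?P (op_adj ?P) k j = op_id D Q k j"
        unfolding k'(2)
        using kj k' cnj_omega_power shift_basis[OF D]
        by (auto simp: pauli_op_mult[OF D Q] op_adj_def pauli_op_eq[OF D] op_id_def)
    qed (simp_all add: supported_op_mult supported_op_adj supported_pauli_op supported_op_id)
  qed
  fix x' z'
  \<comment> \<open>The commutator exponent z . x' - z' . x, with \<open>D - 1\<close> for the minus
    sign.\<close>
  let ?e = "(\<Sum>i\<in>Q. z i * x' i) + (D - 1) * (\<Sum>i\<in>Q. z' i * x i)"
  show "\<exists>c\<in>pauli_phases D. op_mult D Q ?P (pauli_op D Q 1 x' z') =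
    op_mult D Q (pauli_op D Q c (fst (id (x', z'))) (snd (id (x', z')))) ?P"
  proof (rule bexI)
    have "[(\<Sum>i\<in>Q. z i * x' i) = ?e + (\<Sum>i\<in>Q. z' i * x i)] (mod D)"
    proof -
      have "?e + (\<Sum>i\<in>Q. z' i * x i) = (\<Sum>i\<in>Q. z i * x' i) + D * (\<Sum>i\<in>Q. z' i * x i)"
        using D by (cases D) (auto simp: algebra_simps)
      then show ?thesis by (simp only: cong_def mod_mult_self2)
    qed
    then have "omega D ^ (\<Sum>i\<in>Q. z i * x' i) = omega D ^ ?e * omega D ^ (\<Sum>i\<in>Q. z' i * x i)"
      unfolding power_add[symmetric] by (rule omega_power_cong)
    then show "op_mult D Q ?P (pauli_op D Q 1 x' z') =
      op_mult D Q (pauli_op D Q (omega D ^ ?e) (fst (id (x', z'))) (snd (id (x', z')))) ?P"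
      by (simp add: pauli_op_product[OF D Q] add.commute)
  qed (intro pauli_phases_power omega_in_phases D)
qed

section \<open>Diagonal gates with quadratic phases\<close>

definition diagonal_op :: "nat \<Rightarrow> nat set \<Rightarrow> (idx \<Rightarrow> complex) \<Rightarrow> qop" where
  "diagonal_op D Q f = (\<lambda>k j. if k \<in> basis D Q \<and> j = k then f k else 0)"

lemma supported_diagonal_op: "supported D Q (diagonal_op D Q f)"
  by (auto simp: supported_def diagonal_op_def)

lemma unitary_diagonal_op:
  assumes "finite Q" "\<And>j. norm (f j) = 1"
  shows "unitary_op D Q (diagonal_op D Q f)"
proof -
  have mult: "op_mult D Q (diagonal_op D Q g) (diagonal_op D Q h) = diagonal_op D Q (\<lambda>k. g k * h k)"
    for g h
  proof (intro ext)
    fix k j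
    have "(\<Sum>l\<in>basis D Q. diagonal_op D Q g k l * diagonal_op D Q h l j) =
      (\<Sum>l\<in>basis D Q. if l = k then diagonal_op D Q (\<lambda>k. g k * h k) k j else 0)"
      by (intro sum.cong) (auto simp: diagonal_op_def)
    then show "op_mult D Q (diagonal_op D Q g) (diagonal_op D Q h) k j =
      diagonal_op D Q (\<lambda>k. g k * h k) k j"
      by (simp add: op_mult_def finite_basis assms(1)) (simp add: diagonal_op_def)
  qed
  have adj: "op_adj (diagonal_op D Q f) = diagonal_op D Q (\<lambda>k. cnj (f k))"
    by (intro ext) (auto simp: op_adj_def diagonal_op_def)
  have 1: "f k * cnj (f k) = 1" for k
    using assms(2)[of k] by (simp add: complex_norm_square[symmetric])
  have 2: "cnj (f k) * f k = 1" for k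
    using 1[of k] by (simp only: mult.commute)
  have id: "diagonal_op D Q (\<lambda>_. 1) = op_id D Q"
    by (simp only: diagonal_op_def op_id_def)
  show ?thesis
    using supported_diagonal_op[of D Q f] unfolding unitary_op_def supported_def adj mult 1 2 id
    by blast
qed

text \<open>Controlled-phase gates between qudit \<open>i\<close> and all others, with multiplicities \<open>a\<close>,
  combined with the \<open>a i\<close>-th power of the phase gate on qudit \<open>i\<close>.\<close>

definition star_map :: "nat set \<Rightarrow> nat \<Rightarrow> idx \<Rightarrow> idx \<times> idx \<Rightarrow> idx \<times> idx" where
  "star_map Q i a = (\<lambda>(x, z). (x, \<lambda>k. if k = i then z i + a i * x i + (\<Sum>l\<in>Q - {i}. a l * x l)
                                        else z k + a k * x i))"

text \<open>The gate is diagonal, with omega raised to the quadratic form a_i j_i^2 / 2 + j_i L(j).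
  Translating j by x changes this form by its value at x, which is the scalar, and by its
  polarization, which is linear in j and gives the exponents added to z.\<close>

lemma clifford_map_star:
  assumes D: "D > 0" and Q: "finite Q" and i: "i \<in> Q"
  shows "\<exists>U. clifford_map D Q U (star_map Q i a)"
proof -
  obtain s where s: "s ^ 2 = omega D" "s ^ (D ^ 2) = 1" "s \<in> pauli_phases D"
    using omega_square_root[OF D] .
  have ns: "norm s = 1"
  proof -
    have "norm s ^ 2 = 1" using s(1) by (simp flip: norm_power)
    then have "norm s = 1 \<or> norm s = -1" by (simp only: power2_eq_1_iff)
    then show ?thesis using norm_ge_zero[of s] by linarith
  qed
  define L where "L = (\<lambda>x. \<Sum>l\<in>Q - {i}. a l * x l)"
  define f where "f = (\<lambda>j. s ^ (a i * (j i) ^ 2) * omega D ^ (j i * L j))"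
  let ?U = "diagonal_op D Q f"
  \<comment> \<open>Wrap-around modulo \<open>D\<close> is harmless: \<open>s ^ (D ^ 2) = 1\<close>
    removes the square term, and the even cross term becomes a power of \<open>omega D\<close> with
    exponent a multiple of \<open>D\<close>.\<close>
  have sq: "s ^ ((u mod D) ^ 2) = s ^ (u ^ 2)" for u
  proof -
    define q r where "q = u div D" and "r = u mod D"
    have "u = D * q + r" by (simp add: q_def r_def)
    then have "u ^ 2 = D ^ 2 * q ^ 2 + 2 * (D * (q * r)) + r ^ 2"
      by (simp add: power2_eq_square algebra_simps)
    then have "s ^ (u ^ 2) = (s ^ (D ^ 2)) ^ (q ^ 2) * (s ^ 2) ^ (D * (q * r)) * s ^ (r ^ 2)"
      by (simp add: power_add power_mult)
    moreover have "omega D ^ (D * (q * r)) = 1"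
      by (simp add: omega_power_eq_1_iff[OF D])
    ultimately show ?thesis by (simp add: s r_def)
  qed
  have Lshift: "[L (shift D Q x j) = L j + L x] (mod D)" for x j
  proof -
    have "[L (shift D Q x j) = (\<Sum>l\<in>Q - {i}. a l * j l + a l * x l)] (mod D)"
      unfolding L_def
      by (intro cong_sum) (auto simp: shift_def cong_def mod_simps simp flip: distrib_left)
    then show ?thesis by (simp add: L_def sum.distrib)
  qed
  have fshift: "f (shift D Q x j) =
      s ^ (a i * (x i) ^ 2) * omega D ^ (x i * L x) * f j
      * omega D ^ (j i * (a i * x i + L x) + x i * L j)" for x j
  proof -
    have "s ^ (a i * (shift D Q x j i) ^ 2) = s ^ (a i * (j i + x i) ^ 2)"
      using i sq[of "j i + x i"] by (simp add: shift_def power_mult mult.commute[of "a i"])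
    also have "\<dots> = s ^ (a i * (j i) ^ 2) * s ^ (a i * (x i) ^ 2) * (s ^ 2) ^ (a i * x i * j i)"
      by (simp add: power2_eq_square algebra_simps flip: power_add power_mult)
    finally have 1: "s ^ (a i * (shift D Q x j i) ^ 2) =
      s ^ (a i * (j i) ^ 2) * s ^ (a i * (x i) ^ 2) * omega D ^ (a i * x i * j i)"
      by (simp add: s)
    have "[shift D Q x j i * L (shift D Q x j) = (j i + x i) * (L j + L x)] (mod D)"
      using i by (intro cong_mult Lshift) (simp add: shift_def cong_def)
    then have 2: "omega D ^ (shift D Q x j i * L (shift D Q x j)) =
        omega D ^ ((j i + x i) * (L j + L x))"
      by (rule omega_power_cong)
    show ?thesis
      unfolding f_def 1 2 by (simp add: algebra_simps power_add)
  qed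
  have dot: "(\<Sum>k\<in>Q. snd (star_map Q i a (x, z)) k * j k) =
    (\<Sum>k\<in>Q. z k * j k) + (j i * (a i * x i + L x) + x i * L j)" for x z j
  proof -
    have "(\<Sum>k\<in>Q. snd (star_map Q i a (x, z)) k * j k) =
        (z i + a i * x i + L x) * j i + (\<Sum>k\<in>Q - {i}. (z k + a k * x i) * j k)"
      by (subst sum.remove[OF Q i]) (auto simp: star_map_def L_def intro!: sum.cong)
    also have "(\<Sum>k\<in>Q - {i}. (z k + a k * x i) * j k) = (\<Sum>k\<in>Q - {i}. z k * j k) + x i * L j"
      by (simp add: L_def sum_distrib_left sum.distrib algebra_simps)
    also have "(z i + a i * x i + L x) * j i + ((\<Sum>k\<in>Q - {i}. z k * j k) + x i * L j) =
      (z i * j i + (\<Sum>k\<in>Q - {i}. z k * j k)) + (j i * (a i * x i + L x) + x i * L j)"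
      by (simp add: algebra_simps)
    finally show ?thesis by (simp only: sum.remove[OF Q i, of "\<lambda>k. z k * j k"])
  qed
  have "clifford_map D Q ?U (star_map Q i a)"
    unfolding clifford_map_def
  proof (intro conjI allI)
    show "unitary_op D Q ?U"
      by (rule unitary_diagonal_op[OF Q]) (simp add: f_def norm_mult norm_power ns)
    fix x z
    let ?c = "s ^ (a i * (x i) ^ 2) * omega D ^ (x i * L x)"
    show "\<exists>c\<in>pauli_phases D. op_mult D Q ?U (pauli_op D Q 1 x z) =
        op_mult D Q (pauli_op D Q c (fst (star_map Q i a (x, z))) (snd (star_map Q i a (x, z)))) ?U"
    proof (rule bexI[of _ ?c])
      show "?c \<in> pauli_phases D"
        by (intro pauli_phases_mult pauli_phases_power omega_in_phases D s)
      show "op_mult D Q ?U (pauli_op D Q 1 x z) =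
        op_mult D Q (pauli_op D Q ?c (fst (star_map Q i a (x, z))) (snd (star_map Q i a (x, z)))) ?U"
      proof (rule pauli_op_intertwine[OF D Q supported_diagonal_op])
        fix k j assume kj: "k \<in> basis D Q" "j \<in> basis D Q"
        have fst: "fst (star_map Q i a (x, z)) = x" by (simp add: star_map_def)
        have inj: "shift D Q x j = shift D Q x k \<longleftrightarrow> j = k"
          using bij_betw_shift[OF D, of Q x] kj by (auto simp: bij_betw_def inj_on_def)
        show "?U (shift D Q (fst (star_map Q i a (x, z))) k) (shift D Q x j) *
            (1 * omega D ^ (\<Sum>i\<in>Q. z i * j i)) =
          ?c * omega D ^ (\<Sum>k'\<in>Q. snd (star_map Q i a (x, z)) k' * k k') * ?U k j"
        proof (cases "j = k")
          case True
          have "?U (shift D Q x k) (shift D Q x k) = f (shift D Q x k)" "?U k k = f k"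
            using kj by (simp_all add: diagonal_op_def shift_basis[OF D])
          then show ?thesis
            unfolding True fst dot fshift by (simp add: power_add mult_ac)
        next
          case False
          then show ?thesis unfolding fst using inj by (simp add: diagonal_op_def)
        qed
      qed
    qed
  qed
  then show ?thesis by blast
qed

section \<open>The Fourier gate on one qudit\<close>

definition fourier_op :: "nat \<Rightarrow> nat set \<Rightarrow> nat \<Rightarrow> qop" where
  "fourier_op D Q i = (\<lambda>k j. if k \<in> basis D Q \<and> j \<in> basis D Q \<and> (\<forall>l. l \<noteq> i \<longrightarrow> k l = j l)
     then omega D ^ (k i * j i) / of_real (sqrt (real D)) else 0)"

text \<open>A geometric sum with ratio omega^(a - b), where the conjugate replaces subtraction of
  naturals. The ratio is a \<open>D\<close>-th root of unity, and it differs from 1 for distinct a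
  and b below \<open>D\<close>.\<close>

lemma sum_omega_characters:
  assumes D: "D > 0" and "a < D" "b < D"
  shows "(\<Sum>v<D. omega D ^ (a * v) * cnj (omega D ^ (b * v))) = (if a = b then of_nat D else 0)"
proof (cases "a = b")
  case True
  then show ?thesis by (simp only: cnj_omega_power) simp
next
  case False
  define q where "q = omega D ^ a * cnj (omega D ^ b)"
  have "q \<noteq> 1"
  proof
    assume "q = 1"
    then have "omega D ^ a * (omega D ^ b * cnj (omega D ^ b)) = omega D ^ b"
      by (simp add: q_def mult_ac)
    then have eq: "omega D ^ a = omega D ^ b" by (simp only: cnj_omega_power mult_1_right)
    have *: "u = v" if "u \<le> v" "v < D" "omega D ^ u = omega D ^ v" for u v
    proof -
      have "omega D ^ v = omega D ^ u * omega D ^ (v - u)"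
        by (metis le_add_diff_inverse power_add that(1))
      then have "omega D ^ (v - u) = 1"
        using that by (auto simp: omega_def)
      then have "D dvd v - u" by (simp add: omega_power_eq_1_iff[OF D])
      then show ?thesis using that by (auto dest: dvd_imp_le)
    qed
    show False using *[of a b] *[of b a] eq assms False by (cases "a \<le> b") auto
  qed
  moreover have "q ^ D = 1"
    using omega_power_eq_1_iff[OF D, of "a * D"] omega_power_eq_1_iff[OF D, of "b * D"]
    by (simp add: q_def power_mult_distrib flip: power_mult complex_cnj_power)
  ultimately have "(\<Sum>v<D. q ^ v) = 0" by (simp add: sum_gp_strict)
  moreover have "q ^ v = omega D ^ (a * v) * cnj (omega D ^ (b * v))" for v
    by (simp add: q_def power_mult_distrib power_mult)
  ultimately show ?thesis using False by simp
qed

lemma supported_fourier_op: "supported D Q (fourier_op D Q i)"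
  by (auto simp: fourier_op_def supported_def split: if_splits)

lemma fourier_op_mult_adj:
  assumes D: "D > 0" and Q: "finite Q" and i: "i \<in> Q"
  shows "op_mult D Q (fourier_op D Q i) (op_adj (fourier_op D Q i)) = op_id D Q"
proof (rule op_ext[of D Q])
  let ?F = "fourier_op D Q i"
  fix k j assume kj: "k \<in> basis D Q" "j \<in> basis D Q"
  \<comment> \<open>Row \<open>k\<close> is supported on the indices that agree with
    \<open>k\<close> off \<open>i\<close>, so the sum over the basis becomes a sum over the value at
    \<open>i\<close>.\<close>
  let ?A = "(\<lambda>v. k(i := v)) ` {..<D}"
  have A: "?A \<subseteq> basis D Q" using kj i by (auto simp: basis_def)
  have inj: "inj_on (\<lambda>v. k(i := v)) {..<D}" by (auto simp: inj_on_def dest: fun_upd_eqD)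
  have "?F k l = 0" if "l \<in> basis D Q - ?A" for l
  proof -
    have "l = k(i := l i)" if "\<forall>u. u \<noteq> i \<longrightarrow> k u = l u" using that by auto
    moreover have "l i < D" using that i by (auto simp: basis_def)
    ultimately show ?thesis using that by (auto simp: fourier_op_def)
  qed
  then have "op_mult D Q ?F (op_adj ?F) k j = (\<Sum>l\<in>?A. ?F k l * cnj (?F j l))"
    unfolding op_mult_def op_adj_def using A finite_basis[OF Q] by (intro sum.mono_neutral_right) auto
  also have "\<dots> = (\<Sum>v<D. ?F k (k(i := v)) * cnj (?F j (k(i := v))))"
    by (simp add: sum.reindex[OF inj])
  also have "\<dots> = op_id D Q k j"
  proof (cases "\<forall>u. u \<noteq> i \<longrightarrow> k u = j u")
    case True
    have kv: "k(i := v) \<in> basis D Q" if "v < D" for v using that A by auto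
    have "(\<Sum>v<D. ?F k (k(i := v)) * cnj (?F j (k(i := v)))) =
      (\<Sum>v<D. (omega D ^ (k i * v) * cnj (omega D ^ (j i * v))) / of_nat D)"
    proof (intro sum.cong refl)
      fix v assume "v \<in> {..<D}"
      moreover have "complex_of_real (sqrt (real D)) * complex_of_real (sqrt (real D)) = of_nat D"
        by (simp flip: of_real_mult)
      ultimately show "?F k (k(i := v)) * cnj (?F j (k(i := v))) =
        (omega D ^ (k i * v) * cnj (omega D ^ (j i * v))) / of_nat D"
        using True kv kj by (simp add: fourier_op_def)
    qed
    also have "\<dots> = (if k i = j i then 1 else 0)"
      unfolding sum_divide_distrib[symmetric]
      using sum_omega_characters[OF D, of "k i" "j i"] D kj i by (auto simp: basis_def)
    also have "k i = j i \<longleftrightarrow> k = j" using True by (metis ext)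
    also have "(if k = j then 1 else 0) = op_id D Q k j" using kj by (auto simp: op_id_def)
    finally show ?thesis .
  next
    case False
    then have "?F j (k(i := v)) = 0" for v by (auto simp: fourier_op_def)
    then show ?thesis using False by (auto simp: op_id_def)
  qed
  finally show "op_mult D Q ?F (op_adj ?F) k j = op_id D Q k j" .
qed (simp_all add: supported_fourier_op supported_op_mult supported_op_adj supported_op_id)

lemma unitary_fourier_op:
  assumes "D > 0" "finite Q" "i \<in> Q"
  shows "unitary_op D Q (fourier_op D Q i)"
proof -
  let ?F = "fourier_op D Q i"
  \<comment> \<open>For a symmetric matrix the product in the other order is the entrywise
    conjugate, and the identity is real.\<close>
  have sym: "?F k j = ?F j k" for k j
    by (auto simp: fourier_op_def mult.commute)
  have "op_mult D Q (op_adj ?F) ?F k j = cnj (op_mult D Q ?F (op_adj ?F) k j)" for k j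
    unfolding op_mult_def op_adj_def by (simp add: sym[of k] sym[of _ j])
  then have "op_mult D Q (op_adj ?F) ?F = op_id D Q"
    unfolding fourier_op_mult_adj[OF assms] by (intro ext) (auto simp: op_id_def)
  then show ?thesis
    using fourier_op_mult_adj[OF assms] supported_fourier_op
    by (simp add: unitary_op_def supported_def)
qed

text \<open>The quarter turn (x, z) -> (-z, x) at qudit \<open>i\<close>.\<close>

definition fourier_map :: "nat \<Rightarrow> nat \<Rightarrow> idx \<times> idx \<Rightarrow> idx \<times> idx" where
  "fourier_map D i = (\<lambda>(x, z). (x(i := z i * (D - 1)), z(i := x i)))"

lemma clifford_map_fourier:
  assumes D: "D > 0" and Q: "finite Q" and i: "i \<in> Q"
  shows "clifford_map D Q (fourier_op D Q i) (fourier_map D i)"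
  unfolding clifford_map_def
proof (intro conjI allI)
  let ?F = "fourier_op D Q i"
  show "unitary_op D Q ?F" by (rule unitary_fourier_op[OF assms])
  fix x z :: idx
  \<comment> \<open>Conjugation sends X^x Z^z at qudit \<open>i\<close> to Z^x X^(-z); putting the
    X-part first costs omega^(-x z).\<close>
  let ?c = "omega D ^ (z i * (D - 1) * x i)"
  let ?x = "x(i := z i * (D - 1))" and ?z = "z(i := x i)"
  show "\<exists>c\<in>pauli_phases D. op_mult D Q ?F (pauli_op D Q 1 x z) =
    op_mult D Q (pauli_op D Q c (fst (fourier_map D i (x, z))) (snd (fourier_map D i (x, z)))) ?F"
  proof (rule bexI[of _ ?c])
    show "?c \<in> pauli_phases D" by (intro pauli_phases_power omega_in_phases D)
    have "op_mult D Q ?F (pauli_op D Q 1 x z) = op_mult D Q (pauli_op D Q ?c ?x ?z) ?F"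
    proof (rule pauli_op_intertwine[OF D Q supported_fourier_op])
      fix k j assume kj: "k \<in> basis D Q" "j \<in> basis D Q"
      have off: "shift D Q ?x k l = shift D Q x j l \<longleftrightarrow> k l = j l" if "l \<noteq> i" for l
      proof (cases "l \<in> Q")
        case True
        then have "k l < D" "j l < D" using kj by (auto simp: basis_def)
        moreover have "[k l + x l = j l + x l] (mod D) \<longleftrightarrow> [k l = j l] (mod D)"
          by (rule cong_add_rcancel_nat)
        ultimately show ?thesis using True that by (simp add: shift_def cong_def)
      next
        case False
        then show ?thesis using kj by (auto simp: basis_def shift_def)
      qed
      show "?F (shift D Q ?x k) (shift D Q x j) * (1 * omega D ^ (\<Sum>i\<in>Q. z i * j i)) =
        ?c * omega D ^ (\<Sum>l\<in>Q. ?z l * k l) * ?F k j"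
      proof (cases "\<forall>l. l \<noteq> i \<longrightarrow> k l = j l")
        case False
        then show ?thesis using off by (auto simp: fourier_op_def)
      next
        case True
        let ?R = "\<Sum>l\<in>Q - {i}. z l * j l"
        have s1: "(\<Sum>l\<in>Q. z l * j l) = z i * j i + ?R" by (rule sum.remove[OF Q i])
        have s2: "(\<Sum>l\<in>Q. ?z l * k l) = x i * k i + ?R"
          unfolding sum.remove[OF Q i] using True by (auto intro!: sum.cong)
        have "[shift D Q ?x k i * shift D Q x j i = (k i + z i * (D - 1)) * (j i + x i)] (mod D)"
          using i by (intro cong_mult) (auto simp: shift_def cong_def)
        then have 1: "omega D ^ (shift D Q ?x k i * shift D Q x j i) =
            omega D ^ ((k i + z i * (D - 1)) * (j i + x i))"
          by (rule omega_power_cong)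
        have "(k i + z i * (D - 1)) * (j i + x i) + z i * j i =
          z i * (D - 1) * x i + x i * k i + k i * j i + D * (z i * j i)"
          using D by (cases D) (auto simp: algebra_simps)
        then have 2: "omega D ^ ((k i + z i * (D - 1)) * (j i + x i) + z i * j i) =
            omega D ^ (z i * (D - 1) * x i + x i * k i + k i * j i)"
          by (intro omega_power_cong) (simp only: cong_def mod_mult_self2)
        have "?F (shift D Q ?x k) (shift D Q x j) * (1 * omega D ^ (\<Sum>i\<in>Q. z i * j i)) =
          omega D ^ ((k i + z i * (D - 1)) * (j i + x i) + z i * j i) * omega D ^ ?R
            / of_real (sqrt (real D))"
          using True off 1 by (simp add: fourier_op_def shift_basis[OF D] s1 power_add)
        also have "\<dots> = ?c * omega D ^ (\<Sum>l\<in>Q. ?z l * k l) * ?F k j"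
          unfolding 2 s2 using True kj by (simp add: fourier_op_def power_add)
        finally show ?thesis .
      qed
    qed
    then show "op_mult D Q ?F (pauli_op D Q 1 x z) =
      op_mult D Q (pauli_op D Q ?c (fst (fourier_map D i (x, z))) (snd (fourier_map D i (x, z)))) ?F"
      by (simp add: fourier_map_def)
  qed
qed

section \<open>Isotropic families of Pauli exponents\<close>

definition symp_form :: "nat set \<Rightarrow> idx \<times> idx \<Rightarrow> idx \<times> idx \<Rightarrow> int" where
  "symp_form Q v w = (\<Sum>k\<in>Q. int (fst v k) * int (snd w k) - int (snd v k) * int (fst w k))"

text \<open>The form is tracked modulo \<open>p\<close> because that is how the elimination reads
  it. The multiples of \<open>D\<close> that \<open>fourier_map\<close> introduces through
  \<open>D - 1\<close> then disappear, since \<open>p\<close> divides \<open>D\<close>.\<close>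

definition symplectic_clifford :: "nat \<Rightarrow> nat \<Rightarrow> nat set \<Rightarrow> (idx \<times> idx \<Rightarrow> idx \<times> idx) \<Rightarrow> bool" where
  "symplectic_clifford p D Q f \<longleftrightarrow> (\<exists>U. clifford_map D Q U f) \<and>
     (\<forall>v w. [symp_form Q (f v) (f w) = symp_form Q v w] (mod int p))"

lemma symplectic_clifford_id: "D > 0 \<Longrightarrow> finite Q \<Longrightarrow> symplectic_clifford p D Q id"
  using clifford_map_id by (auto simp: symplectic_clifford_def)

lemma symplectic_clifford_comp:
  assumes "D > 0" "finite Q" "symplectic_clifford p D Q f" "symplectic_clifford p D Q g"
  shows "symplectic_clifford p D Q (f \<circ> g)"
  using assms clifford_map_comp[OF assms(1,2)]
  unfolding symplectic_clifford_def by (metis comp_apply cong_trans)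

text \<open>The star gate adds A x to z for a symmetric matrix A, and the contributions x . A x' and
  A x . x' cancel.\<close>

lemma symp_form_star:
  assumes Q: "finite Q" and i: "i \<in> Q"
  shows "symp_form Q (star_map Q i a v) (star_map Q i a w) = symp_form Q v w"
proof -
  obtain x z x' z' where v: "v = (x, z)" "w = (x', z')" by fastforce
  let ?L = "\<lambda>x. \<Sum>l\<in>Q - {i}. int (a l) * int (x l)"
  let ?t = "\<lambda>k. int (x k) * int (z' k) - int (z k) * int (x' k)"
  have "symp_form Q (star_map Q i a v) (star_map Q i a w) =
    (int (x i) * (int (z' i) + int (a i) * int (x' i) + ?L x')
      - (int (z i) + int (a i) * int (x i) + ?L x) * int (x' i)) +
    (\<Sum>k\<in>Q - {i}. int (x k) * (int (z' k) + int (a k) * int (x' i))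
      - (int (z k) + int (a k) * int (x i)) * int (x' k))"
    unfolding symp_form_def by (subst sum.remove[OF Q i]) (simp add: star_map_def v)
  also have "(\<Sum>k\<in>Q - {i}. int (x k) * (int (z' k) + int (a k) * int (x' i))
      - (int (z k) + int (a k) * int (x i)) * int (x' k)) =
    (\<Sum>k\<in>Q - {i}. ?t k) + int (x' i) * ?L x - int (x i) * ?L x'"
    by (simp add: sum_distrib_left sum.distrib sum_subtractf algebra_simps)
  finally have "symp_form Q (star_map Q i a v) (star_map Q i a w) = ?t i + (\<Sum>k\<in>Q - {i}. ?t k)"
    by (simp add: algebra_simps)
  also have "\<dots> = symp_form Q v w"
    unfolding symp_form_def by (simp add: sum.remove[OF Q i] v)
  finally show ?thesis .
qed

lemma symplectic_clifford_star:
  "D > 0 \<Longrightarrow> finite Q \<Longrightarrow> i \<in> Q \<Longrightarrow> symplectic_clifford p D Q (star_map Q i a)"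
  using clifford_map_star symp_form_star by (simp add: symplectic_clifford_def)

lemma symp_form_fourier:
  assumes Q: "finite Q" and i: "i \<in> Q" and D: "D > 0"
  shows "[symp_form Q (fourier_map D i v) (fourier_map D i w) = symp_form Q v w] (mod int D)"
proof -
  obtain x z x' z' where v: "v = (x, z)" "w = (x', z')" by fastforce
  let ?t = "\<lambda>k. int (x k) * int (z' k) - int (z k) * int (x' k)"
  have "symp_form Q (fourier_map D i v) (fourier_map D i w) =
    (int (z i) * (int D - 1) * int (x' i) - int (x i) * (int (z' i) * (int D - 1)))
      + (\<Sum>k\<in>Q - {i}. ?t k)"
    unfolding symp_form_def using D by (subst sum.remove[OF Q i]) (simp add: fourier_map_def v of_nat_diff)
  also have "\<dots> = symp_form Q v w - int D * ?t i"
    unfolding symp_form_def by (simp add: sum.remove[OF Q i] v algebra_simps)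
  finally show ?thesis by (simp add: cong_iff_dvd_diff)
qed

lemma symplectic_clifford_fourier:
  assumes "D > 0" "finite Q" "i \<in> Q" "p dvd D"
  shows "symplectic_clifford p D Q (fourier_map D i)"
proof -
  have "int p dvd int D" using assms by simp
  then show ?thesis
    unfolding symplectic_clifford_def
    using symp_form_fourier[OF assms(2,3,1)] clifford_map_fourier[OF assms(1-3)]
    by (meson cong_dvd_modulus)
qed

section \<open>Elimination over the residue field\<close>

lemma prime_solve_linear:
  fixes p :: nat
  assumes "prime p" "\<not> p dvd x"
  shows "\<exists>a. p dvd z + a * x"
proof -
  have "coprime x p" using assms by (metis coprime_commute prime_imp_coprime)
  then obtain y where y: "[x * y = 1] (mod p)" using cong_solve_coprime_nat by auto
  \<comment> \<open>The solution is a = -z / x in the field with \<open>p\<close> elements, with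
    \<open>p - 1\<close> for -1 and \<open>y\<close> for the inverse of x.\<close>
  have "[z + z * (p - 1) * (x * y) = z + z * (p - 1) * 1] (mod p)"
    by (intro cong_add cong_mult y) simp_all
  moreover have "z + z * (p - 1) * 1 = p * z"
    using prime_gt_0_nat[OF assms(1)] by (cases p) auto
  ultimately have "p dvd z + z * (p - 1) * (x * y)"
    by (metis cong_dvd_iff dvd_triv_left)
  then show ?thesis by (metis mult.assoc mult.commute)
qed

text \<open>A power of the phase gate makes the Z-exponent of \<open>v\<close> at \<open>k\<close>
  divisible by \<open>p\<close>, and the Fourier gate then turns it into the X-exponent. Both act on
  qudit \<open>k\<close> alone, hence the statement about every other X-exponent of every
  \<open>w\<close>.\<close>

lemma clear_x_coordinate:
  assumes p: "prime p" "p dvd D" and D: "D > 0" and Q: "finite Q" and k: "k \<in> Q"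
  shows "\<exists>f. symplectic_clifford p D Q f \<and> (\<forall>w l. l \<noteq> k \<longrightarrow> fst (f w) l = fst w l) \<and>
    p dvd fst (f v) k"
proof (cases "p dvd fst v k")
  case True
  then show ?thesis using symplectic_clifford_id[OF D Q] by (intro exI[of _ id]) simp
next
  case False
  then obtain a where a: "p dvd snd v k + a * fst v k" using prime_solve_linear[OF p(1)] by blast
  define f where "f = fourier_map D k \<circ> star_map Q k (\<lambda>l. if l = k then a else 0)"
  have "symplectic_clifford p D Q f"
    unfolding f_def
    by (intro symplectic_clifford_comp symplectic_clifford_fourier symplectic_clifford_star D Q k p)
  moreover have "fst (f w) l = fst w l" if "l \<noteq> k" for w l
    using that by (simp add: f_def star_map_def fourier_map_def split: prod.split)
  moreover have "fst (f v) k = (snd v k + a * fst v k) * (D - 1)"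
    by (simp add: f_def star_map_def fourier_map_def split: prod.split)
  ultimately show ?thesis using a by auto
qed

lemma clear_x_coordinates:
  assumes p: "prime p" "p dvd D" and D: "D > 0" and Q: "finite Q" and "finite R" "R \<subseteq> Q"
  shows "\<exists>f. symplectic_clifford p D Q f \<and> (\<forall>w l. l \<notin> R \<longrightarrow> fst (f w) l = fst w l) \<and>
    (\<forall>k\<in>R. p dvd fst (f v) k)"
  using assms(5,6)
proof (induction R rule: finite_induct)
  case empty
  then show ?case by (intro exI[of _ id] conjI symplectic_clifford_id D Q) simp_all
next
  case (insert k R)
  then obtain f where f: "symplectic_clifford p D Q f" "\<forall>w l. l \<notin> R \<longrightarrow> fst (f w) l = fst w l"
    "\<forall>k\<in>R. p dvd fst (f v) k" by auto
  obtain g where g: "symplectic_clifford p D Q g" "\<forall>w l. l \<noteq> k \<longrightarrow> fst (g w) l = fst w l"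
    "p dvd fst (g (f v)) k"
    using clear_x_coordinate[OF p D Q, of k "f v"] insert.prems by auto
  show ?case
  proof (intro exI[of _ "g \<circ> f"] conjI allI impI ballI)
    show "symplectic_clifford p D Q (g \<circ> f)"
      by (rule symplectic_clifford_comp[OF D Q g(1) f(1)])
    show "fst ((g \<circ> f) w) l = fst w l" if "l \<notin> insert k R" for w l
      using that f(2)[rule_format, of l w] g(2)[rule_format, of l "f w"] by simp
    show "p dvd fst ((g \<circ> f) v) l" if "l \<in> insert k R" for l
    proof (cases "l = k")
      case False
      then have "l \<in> R" using that by simp
      then show ?thesis
        using False f(3) g(2)[rule_format, of l "f v"] by simp
    qed (use g(3) in simp)
  qed
qed

text \<open>Once \<open>v\<close> is reduced to a multiple of \<open>X\<close> on qudit \<open>i\<close>, commutation with \<open>v\<close> forces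
  the \<open>Z\<close>-exponent at \<open>i\<close> of every vector to vanish, and a Fourier transform finishes.\<close>

lemma clear_qudit:
  assumes p: "prime p" "p dvd D" and D: "D > 0" and Q: "finite Q"
    and i: "i \<in> Q" and T: "T \<subseteq> Q" "i \<notin> T"
    and G: "\<And>v w. v \<in> G \<Longrightarrow> w \<in> G \<Longrightarrow> int p dvd symp_form Q v w"
    and GT: "\<And>v k. v \<in> G \<Longrightarrow> k \<in> T \<Longrightarrow> p dvd fst v k"
  shows "\<exists>f. symplectic_clifford p D Q f \<and> (\<forall>v\<in>G. \<forall>k\<in>insert i T. p dvd fst (f v) k)"
proof (cases "\<forall>v\<in>G. p dvd fst v i")
  case True
  then show ?thesis using symplectic_clifford_id[OF D Q] GT by (intro exI[of _ id]) auto
next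
  case False
  then obtain v where v: "v \<in> G" "\<not> p dvd fst v i" by blast
  \<comment> \<open>Sparing \<open>T\<close> and \<open>i\<close> preserves the X-exponents already
    cleared for all of \<open>G\<close>, and the pivot entry of \<open>v\<close>.\<close>
  obtain f where f: "symplectic_clifford p D Q f"
    "\<And>w l. l \<notin> Q - T - {i} \<Longrightarrow> fst (f w) l = fst w l"
    "\<And>k. k \<in> Q - T - {i} \<Longrightarrow> p dvd fst (f v) k"
    using clear_x_coordinates[OF p D Q, of "Q - T - {i}" v] Q by blast
  have fvi: "fst (f v) i = fst v i" using f(2)[of i] by simp
  have fvl: "p dvd fst (f v) l" if "l \<in> Q - {i}" for l
    using that f(2)[of l v] f(3)[of l] GT[OF v(1), of l] by (cases "l \<in> T") auto
  \<comment> \<open>The pivot entry is invertible modulo \<open>p\<close>, so each Z-exponent of the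
    pivot vector is cancelled by a suitable multiplicity in the star gate.\<close>
  have "\<forall>k. \<exists>a. p dvd snd (f v) k + a * fst v i"
    using prime_solve_linear[OF p(1) v(2)] by blast
  from choice[OF this] obtain a where a: "\<And>k. p dvd snd (f v) k + a k * fst v i"
    by blast
  define h where "h = star_map Q i a \<circ> f"
  have h: "symplectic_clifford p D Q h"
    unfolding h_def by (intro symplectic_clifford_comp symplectic_clifford_star D Q i f)
  have hx: "fst (h w) = fst (f w)" for w
    by (simp add: h_def star_map_def split: prod.split)
  have hz: "p dvd snd (h v) k" for k
  proof (cases "k = i")
    case True
    have "snd (h v) i = (snd (f v) i + a i * fst v i) + (\<Sum>l\<in>Q - {i}. a l * fst (f v) l)"
      by (simp add: h_def star_map_def fvi[symmetric] split: prod.split)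
    \<comment> \<open>The other edges of the star also contribute to the Z-exponent at
      \<open>i\<close>, but only multiples of \<open>p\<close>, since the pivot vector has
      X-exponents divisible by \<open>p\<close> off \<open>i\<close>.\<close>
    moreover have "p dvd (\<Sum>l\<in>Q - {i}. a l * fst (f v) l)"
      by (intro dvd_sum dvd_mult fvl)
    ultimately show ?thesis using a[of i] True by simp
  next
    case False
    then have "snd (h v) k = snd (f v) k + a k * fst v i"
      by (simp add: h_def star_map_def fvi[symmetric] split: prod.split)
    then show ?thesis using a by simp
  qed
  have hw: "p dvd snd (h w) i" if w: "w \<in> G" for w
  proof -
    let ?s = "\<lambda>k. int (fst (h v) k) * int (snd (h w) k) - int (snd (h v) k) * int (fst (h w) k)"
    have "[symp_form Q (h v) (h w) = symp_form Q v w] (mod int p)"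
      using conjunct2[OF h[unfolded symplectic_clifford_def]] by blast
    then have "int p dvd symp_form Q (h v) (h w)"
      using G[OF v(1) w] by (simp only: cong_dvd_iff)
    moreover have "symp_form Q (h v) (h w) = ?s i + (\<Sum>k\<in>Q - {i}. ?s k)"
      unfolding symp_form_def by (rule sum.remove[OF Q i])
    moreover have "int p dvd (\<Sum>k\<in>Q - {i}. ?s k)"
      using fvl hz by (intro dvd_sum dvd_diff dvd_mult2) (auto simp: hx)
    ultimately have "int p dvd ?s i" by (simp only: dvd_add_left_iff)
    moreover have "int p dvd int (snd (h v) i) * int (fst (h w) i)"
      using hz by (intro dvd_mult2) auto
    ultimately have "int p dvd int (fst (h v) i) * int (snd (h w) i)"
      by (simp only: dvd_diff_left_iff)
    then have "p dvd fst (h v) i * snd (h w) i" by (simp flip: of_nat_mult)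
    moreover have "\<not> p dvd fst (h v) i" using v(2) fvi by (simp add: hx)
    ultimately show ?thesis using p(1) by (simp add: prime_dvd_mult_iff)
  qed
  define g where "g = fourier_map D i \<circ> h"
  have "symplectic_clifford p D Q g"
    unfolding g_def by (intro symplectic_clifford_comp symplectic_clifford_fourier D Q i h p)
  moreover have "p dvd fst (g w) k" if "w \<in> G" "k \<in> insert i T" for w k
  proof (cases "k = i")
    case True
    then have "fst (g w) k = snd (h w) i * (D - 1)"
      by (simp add: g_def fourier_map_def split: prod.split)
    then show ?thesis using hw[OF that(1)] by simp
  next
    case False
    then have "fst (g w) k = fst (h w) k"
      by (simp add: g_def fourier_map_def split: prod.split)
    also have "\<dots> = fst w k" using that False f(2)[of k w] by (simp add: hx)
    finally show ?thesis using GT[OF that(1)] that False by simp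
  qed
  ultimately show ?thesis by blast
qed

text \<open>The set \<open>T\<close> of cleared qudits grows one by one. Each gate preserves the
  form modulo \<open>p\<close>, so the transformed family is again isotropic and
  \<open>clear_qudit\<close> applies to it.\<close>

lemma isotropic_to_Z_type:
  assumes p: "prime p" "p dvd D" and D: "D > 0" and Q: "finite Q"
    and G: "\<And>v w. v \<in> G \<Longrightarrow> w \<in> G \<Longrightarrow> int p dvd symp_form Q v w"
  shows "\<exists>U f. clifford_map D Q U f \<and> (\<forall>v\<in>G. \<forall>k\<in>Q. p dvd fst (f v) k)"
proof -
  have "\<exists>f. symplectic_clifford p D Q f \<and> (\<forall>v\<in>G. \<forall>k\<in>T. p dvd fst (f v) k)"
    if "finite T" "T \<subseteq> Q" for T
    using that
  proof (induction T rule: finite_induct)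
    case empty
    then show ?case by (intro exI[of _ id] conjI symplectic_clifford_id D Q) simp
  next
    case (insert i T)
    then obtain f where f: "symplectic_clifford p D Q f" "\<forall>v\<in>G. \<forall>k\<in>T. p dvd fst (f v) k"
      by auto
    have "\<exists>g. symplectic_clifford p D Q g \<and> (\<forall>v\<in>f ` G. \<forall>k\<in>insert i T. p dvd fst (g v) k)"
    proof (rule clear_qudit[OF p D Q])
      fix v w assume "v \<in> f ` G" "w \<in> f ` G"
      then show "int p dvd symp_form Q v w"
        using f(1) G unfolding symplectic_clifford_def by (metis cong_dvd_iff imageE)
    qed (use f insert in auto)
    then obtain g where g: "symplectic_clifford p D Q g"
      "\<forall>v\<in>f ` G. \<forall>k\<in>insert i T. p dvd fst (g v) k" by blast
    have "\<forall>v\<in>G. \<forall>k\<in>insert i T. p dvd fst ((g \<circ> f) v) k" using g(2) by simp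
    then show ?case using symplectic_clifford_comp[OF D Q g(1) f(1)] by (intro exI conjI)
  qed
  from this[OF Q subset_refl] show ?thesis
    unfolding symplectic_clifford_def by blast
qed

section \<open>Tensor products of local operators\<close>

abbreviation part :: "nat set \<Rightarrow> (nat \<Rightarrow> nat) \<Rightarrow> nat \<Rightarrow> nat set" where
  "part Q party \<alpha> \<equiv> {k. k \<in> Q \<and> party k = \<alpha>}"

abbreviation tensor :: "nat \<Rightarrow> nat set \<Rightarrow> nat \<Rightarrow> (nat \<Rightarrow> nat) \<Rightarrow> (nat \<Rightarrow> qop) \<Rightarrow> qop" where
  "tensor D Q m party U \<equiv> local_tensor D Q m (part Q party) U"

lemma restrict_idx_basis: "k \<in> basis D Q \<Longrightarrow> A \<subseteq> Q \<Longrightarrow> restrict_idx A k \<in> basis D A"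
  by (auto simp: basis_def restrict_idx_def)

lemma supported_tensor: "supported D Q (local_tensor D Q m P U)"
  by (auto simp: supported_def local_tensor_def)

lemma tensor_cong:
  "(\<And>\<alpha>. \<alpha> < m \<Longrightarrow> U \<alpha> = V \<alpha>) \<Longrightarrow> local_tensor D Q m P U = local_tensor D Q m P V"
  by (intro ext) (auto simp: local_tensor_def intro!: prod.cong)

lemma tensor_adj: "op_adj (local_tensor D Q m P U) = local_tensor D Q m P (\<lambda>\<alpha>. op_adj (U \<alpha>))"
  by (intro ext) (auto simp: local_tensor_def op_adj_def)

text \<open>A basis index of \<open>Q\<close> amounts to one local basis index per party. This lets
  \<open>prod_sum_PiE\<close> turn a sum over global indices into a product of local sums, which is
  the multiplicativity of the tensor product.\<close>

lemma bij_betw_restrict_parts: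
  assumes "\<forall>i\<in>Q. party i < m"
  shows "bij_betw (\<lambda>k. \<lambda>\<alpha>\<in>{..<m}. restrict_idx (part Q party \<alpha>) k) (basis D Q)
    (PiE {..<m} (\<lambda>\<alpha>. basis D (part Q party \<alpha>)))"
proof (rule bij_betwI[where g = "\<lambda>g i. if i \<in> Q then g (party i) i else 0"])
  show "(\<lambda>k. \<lambda>\<alpha>\<in>{..<m}. restrict_idx (part Q party \<alpha>) k) \<in>
    basis D Q \<rightarrow> (PiE {..<m} (\<lambda>\<alpha>. basis D (part Q party \<alpha>)))"
    using restrict_idx_basis[of _ D Q] by auto
  show "(\<lambda>g i. if i \<in> Q then g (party i) i else 0) \<in>
    (PiE {..<m} (\<lambda>\<alpha>. basis D (part Q party \<alpha>))) \<rightarrow> basis D Q"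
    using assms by (auto simp: basis_def PiE_def Pi_def)
next
  fix k assume "k \<in> basis D Q"
  then show "(\<lambda>i. if i \<in> Q then (\<lambda>\<alpha>\<in>{..<m}. restrict_idx (part Q party \<alpha>) k) (party i) i else 0) = k"
    using assms by (auto simp: basis_def restrict_idx_def fun_eq_iff)
next
  fix g assume g: "g \<in> PiE {..<m} (\<lambda>\<alpha>. basis D (part Q party \<alpha>))"
  show "(\<lambda>\<alpha>\<in>{..<m}. restrict_idx (part Q party \<alpha>) (\<lambda>i. if i \<in> Q then g (party i) i else 0)) = g"
  proof
    fix \<alpha>
    show "(\<lambda>\<alpha>\<in>{..<m}. restrict_idx (part Q party \<alpha>) (\<lambda>i. if i \<in> Q then g (party i) i else 0)) \<alpha>
      = g \<alpha>"
    proof (cases "\<alpha> < m")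
      case True
      then have "g \<alpha> \<in> basis D (part Q party \<alpha>)" using g by auto
      then show ?thesis using True by (auto simp: restrict_idx_def basis_def fun_eq_iff)
    next
      case False
      then show ?thesis using g by (auto simp: PiE_def extensional_def)
    qed
  qed
qed

lemma tensor_mult:
  assumes Q: "finite Q" and m: "\<forall>i\<in>Q. party i < m"
  shows "op_mult D Q (tensor D Q m party U) (tensor D Q m party V) =
    tensor D Q m party (\<lambda>\<alpha>. op_mult D (part Q party \<alpha>) (U \<alpha>) (V \<alpha>))"
proof (rule op_ext[of D Q])
  fix k j assume kj: "k \<in> basis D Q" "j \<in> basis D Q"
  let ?r = "\<lambda>\<alpha>. restrict_idx (part Q party \<alpha>)"
  let ?F = "\<lambda>\<alpha> l. U \<alpha> (?r \<alpha> k) l * V \<alpha> l (?r \<alpha> j)"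
  have "op_mult D Q (tensor D Q m party U) (tensor D Q m party V) k j =
      (\<Sum>l\<in>basis D Q. \<Prod>\<alpha><m. ?F \<alpha> ((\<lambda>\<alpha>\<in>{..<m}. ?r \<alpha> l) \<alpha>))"
    unfolding op_mult_def using kj by (intro sum.cong) (auto simp: local_tensor_def prod.distrib)
  also have "\<dots> = (\<Sum>g\<in>PiE {..<m} (\<lambda>\<alpha>. basis D (part Q party \<alpha>)). \<Prod>\<alpha><m. ?F \<alpha> (g \<alpha>))"
    by (rule sum.reindex_bij_betw[OF bij_betw_restrict_parts[OF m]])
  also have "\<dots> = (\<Prod>\<alpha><m. \<Sum>l\<in>basis D (part Q party \<alpha>). ?F \<alpha> l)"
    by (rule prod_sum_PiE[symmetric]) (use Q in \<open>auto intro!: finite_basis\<close>)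
  finally show "op_mult D Q (tensor D Q m party U) (tensor D Q m party V) k j =
    tensor D Q m party (\<lambda>\<alpha>. op_mult D (part Q party \<alpha>) (U \<alpha>) (V \<alpha>)) k j"
    using kj by (simp add: local_tensor_def op_mult_def)
qed (simp_all add: supported_tensor supported_op_mult)

text \<open>Local exponents are glued along \<open>party\<close>. Their phase exponents add up
  because every qudit belongs to exactly one part; a mismatch at a single qudit kills the factor of
  its party.\<close>

lemma tensor_pauli:
  assumes D: "D > 0" and Q: "finite Q" and m: "\<forall>i\<in>Q. party i < m"
  shows "tensor D Q m party (\<lambda>\<alpha>. pauli_op D (part Q party \<alpha>) (c \<alpha>) (x \<alpha>) (z \<alpha>)) =
    pauli_op D Q (\<Prod>\<alpha><m. c \<alpha>) (\<lambda>i. x (party i) i) (\<lambda>i. z (party i) i)"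
proof (rule op_ext[of D Q])
  fix k j assume kj: "k \<in> basis D Q" "j \<in> basis D Q"
  let ?r = "\<lambda>\<alpha>. restrict_idx (part Q party \<alpha>)"
  have b: "?r \<alpha> k \<in> basis D (part Q party \<alpha>)" "?r \<alpha> j \<in> basis D (part Q party \<alpha>)" for \<alpha>
    using kj by (auto intro: restrict_idx_basis)
  have entry: "pauli_op D (part Q party \<alpha>) (c \<alpha>) (x \<alpha>) (z \<alpha>) (?r \<alpha> k) (?r \<alpha> j) =
    (if \<forall>i\<in>part Q party \<alpha>. k i = (j i + x (party i) i) mod D
     then c \<alpha> * omega D ^ (\<Sum>i\<in>part Q party \<alpha>. z (party i) i * j i) else 0)" for \<alpha>
    using b[of \<alpha>] by (auto simp: pauli_op_def restrict_idx_def intro!: sum.cong)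
  show "tensor D Q m party (\<lambda>\<alpha>. pauli_op D (part Q party \<alpha>) (c \<alpha>) (x \<alpha>) (z \<alpha>)) k j =
    pauli_op D Q (\<Prod>\<alpha><m. c \<alpha>) (\<lambda>i. x (party i) i) (\<lambda>i. z (party i) i) k j"
  proof (cases "\<forall>i\<in>Q. k i = (j i + x (party i) i) mod D")
    case True
    have "(\<Sum>\<alpha><m. \<Sum>i\<in>part Q party \<alpha>. z (party i) i * j i) = (\<Sum>i\<in>Q. z (party i) i * j i)"
      by (rule sum.group) (use Q m in auto)
    then have "(\<Prod>\<alpha><m. omega D ^ (\<Sum>i\<in>part Q party \<alpha>. z (party i) i * j i)) =
        omega D ^ (\<Sum>i\<in>Q. z (party i) i * j i)"
      by (simp flip: power_sum)
    then show ?thesis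
      using True kj by (simp add: local_tensor_def entry prod.distrib) (simp add: pauli_op_def)
  next
    case False
    then obtain i where i: "i \<in> Q" "k i \<noteq> (j i + x (party i) i) mod D" by blast
    then have "(\<Prod>\<alpha><m. pauli_op D (part Q party \<alpha>) (c \<alpha>) (x \<alpha>) (z \<alpha>) (?r \<alpha> k) (?r \<alpha> j)) = 0"
      using m by (intro prod_zero bexI[of _ "party i"]) (auto simp: entry)
    then show ?thesis using False kj by (auto simp: local_tensor_def pauli_op_def)
  qed
qed (simp_all add: supported_tensor supported_pauli_op)

lemma tensor_id:
  assumes "D > 0" "finite Q" "\<forall>i\<in>Q. party i < m"
  shows "tensor D Q m party (\<lambda>\<alpha>. op_id D (part Q party \<alpha>)) = op_id D Q"
  unfolding op_id_eq_pauli_op[OF assms(1)]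
  using tensor_pauli[OF assms, of "\<lambda>_. 1" "\<lambda>_ _. 0" "\<lambda>_ _. 0"] by simp

lemma unitary_tensor:
  assumes D: "D > 0" and Q: "finite Q" and m: "\<forall>i\<in>Q. party i < m"
    and U: "\<And>\<alpha>. \<alpha> < m \<Longrightarrow> unitary_op D (part Q party \<alpha>) (U \<alpha>)"
  shows "unitary_op D Q (tensor D Q m party U)"
proof -
  have "tensor D Q m party (\<lambda>\<alpha>. op_mult D (part Q party \<alpha>) (U \<alpha>) (op_adj (U \<alpha>))) = op_id D Q"
       "tensor D Q m party (\<lambda>\<alpha>. op_mult D (part Q party \<alpha>) (op_adj (U \<alpha>)) (U \<alpha>)) = op_id D Q"
    unfolding tensor_id[OF D Q m, symmetric]
    using U by (auto intro!: tensor_cong simp: unitary_op_def)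
  then show ?thesis
    using supported_tensor[of D Q m "part Q party" U]
    by (simp add: unitary_op_def supported_def tensor_adj tensor_mult[OF Q m])
qed

section \<open>Groups of operators and stabilizer states\<close>

text \<open>The axioms of a stabilizer group with Pauli membership weakened to support on the basis.
  In this form they survive conjugation by any unitary; Pauli form and phases are established
  separately.\<close>

definition op_group :: "nat \<Rightarrow> nat set \<Rightarrow> qop set \<Rightarrow> bool" where
  "op_group D Q S \<longleftrightarrow> (\<forall>s\<in>S. supported D Q s) \<and> op_id D Q \<in> S \<and>
     (\<forall>a\<in>S. \<forall>b\<in>S. op_mult D Q a b \<in> S) \<and>
     (\<forall>a\<in>S. \<exists>b\<in>S. op_mult D Q a b = op_id D Q) \<and>
     (\<forall>a\<in>S. \<forall>b\<in>S. op_mult D Q a b = op_mult D Q b a) \<and>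
     (\<forall>s\<in>S. (\<exists>c. s = op_scale c (op_id D Q)) \<longrightarrow> s = op_id D Q)"

lemma stabilizer_group_iff:
  "stabilizer_group D Q S \<longleftrightarrow> op_group D Q S \<and> S \<subseteq> pauli_group D Q"
proof -
  have "supported D Q s" if "S \<subseteq> pauli_group D Q" "s \<in> S" for s
    using that supported_pauli_op by (fastforce simp: pauli_group_def)
  then show ?thesis unfolding stabilizer_group_def op_group_def by (safe; simp)
qed

lemma op_groupD:
  assumes "op_group D Q S"
  shows "\<And>s. s \<in> S \<Longrightarrow> supported D Q s" "op_id D Q \<in> S"
    "\<And>a b. a \<in> S \<Longrightarrow> b \<in> S \<Longrightarrow> op_mult D Q a b \<in> S"
    "\<And>a. a \<in> S \<Longrightarrow> \<exists>b\<in>S. op_mult D Q a b = op_id D Q"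
    "\<And>a b. a \<in> S \<Longrightarrow> b \<in> S \<Longrightarrow> op_mult D Q a b = op_mult D Q b a"
    "\<And>c. op_scale c (op_id D Q) \<in> S \<Longrightarrow> op_scale c (op_id D Q) = op_id D Q"
  using assms unfolding op_group_def by blast+

lemma op_scale_id_eq_iff:
  assumes "D > 0"
  shows "op_scale c (op_id D Q) = op_id D Q \<longleftrightarrow> c = 1"
proof
  assume "op_scale c (op_id D Q) = op_id D Q"
  then have "op_scale c (op_id D Q) (\<lambda>_. 0) (\<lambda>_. 0) = op_id D Q (\<lambda>_. 0) (\<lambda>_. 0)" by simp
  moreover have "(\<lambda>_. 0) \<in> basis D Q" using assms by (simp add: basis_def)
  ultimately show "c = 1" by (simp add: op_scale_def op_id_def)
qed (simp add: op_scale_1)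

lemma bij_betw_left_mult:
  assumes Q: "finite Q" and S: "op_group D Q S" and s: "s \<in> S"
  shows "bij_betw (op_mult D Q s) S S"
proof -
  note G = op_groupD[OF S]
  obtain b where b: "b \<in> S" "op_mult D Q s b = op_id D Q" using G(4)[OF s] by blast
  then have b': "op_mult D Q b s = op_id D Q" using G(5)[OF s b(1)] by simp
  show ?thesis
  proof (rule bij_betwI[where g = "op_mult D Q b"])
    fix a assume "a \<in> S"
    then show "op_mult D Q b (op_mult D Q s a) = a" "op_mult D Q s (op_mult D Q b a) = a"
      using b b' G(1) by (simp_all add: op_mult_assoc[symmetric] op_mult_id_left[OF Q])
  qed (use G(3) s b(1) in auto)
qed

text \<open>This is the \<open>t\<close>-th power. Moving the Z-parts past the X-parts costs 0 + 1 +
  ... + (t - 1) times z . x.\<close>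

lemma pauli_power_in_group:
  assumes D: "D > 0" and Q: "finite Q" and S: "op_group D Q S" and P: "pauli_op D Q c x z \<in> S"
  shows "pauli_op D Q (c ^ t * omega D ^ ((\<Sum>i\<in>Q. z i * x i) * (t * (t - 1) div 2)))
    (\<lambda>i. t * x i) (\<lambda>i. t * z i) \<in> S"
proof (induction t)
  case 0
  then show ?case using op_groupD(2)[OF S] by (simp add: op_id_eq_pauli_op[OF D])
next
  case (Suc t)
  let ?w = "\<Sum>i\<in>Q. z i * x i"
  have 1: "(\<Sum>i\<in>Q. z i * (t * x i)) = ?w * t"
    by (subst mult.commute[of _ t]) (simp add: sum_distrib_left mult_ac)
  have "Suc t * (Suc t - 1) = t * (t - 1) + 2 * t" by (cases t) auto
  then have 2: "Suc t * (Suc t - 1) div 2 = t * (t - 1) div 2 + t" by simp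
  have "op_mult D Q (pauli_op D Q c x z)
      (pauli_op D Q (c ^ t * omega D ^ (?w * (t * (t - 1) div 2))) (\<lambda>i. t * x i) (\<lambda>i. t * z i)) =
    pauli_op D Q (c ^ Suc t * omega D ^ (?w * (Suc t * (Suc t - 1) div 2)))
      (\<lambda>i. Suc t * x i) (\<lambda>i. Suc t * z i)"
    unfolding pauli_op_product[OF D Q] 1 2 by (simp add: power_add distrib_left mult_ac)
  then show ?case using op_groupD(3)[OF S P Suc] by simp
qed

text \<open>The \<open>D\<close>-th power has exponents divisible by \<open>D\<close>, so it is a
  scalar in \<open>S\<close> and equals the identity. The resulting equation for \<open>c\<close> is
  exactly that of an admissible phase, whatever its origin.\<close>

lemma phase_of_group_element:
  assumes D: "D > 0" and Q: "finite Q" and S: "op_group D Q S" and P: "pauli_op D Q c x z \<in> S"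
  shows "c \<in> pauli_phases D"
proof -
  let ?w = "\<Sum>i\<in>Q. z i * x i"
  let ?c = "c ^ D * omega D ^ (?w * (D * (D - 1) div 2))"
  have "pauli_op D Q ?c (\<lambda>i. D * x i) (\<lambda>i. D * z i) = pauli_op D Q ?c (\<lambda>_. 0) (\<lambda>_. 0)"
    by (rule pauli_op_cong[OF D]) (simp_all add: cong_def)
  also have "\<dots> = op_scale ?c (op_id D Q)"
    unfolding op_id_eq_pauli_op[OF D] by (rule pauli_op_scale)
  finally have "op_scale ?c (op_id D Q) \<in> S"
    using pauli_power_in_group[OF D Q S P, of D] by simp
  then have c: "?c = 1"
    using op_groupD(6)[OF S] op_scale_id_eq_iff[OF D] by blast
  show ?thesis
  proof (cases "even D")
    case True
    \<comment> \<open>For even \<open>D\<close> the number D (D - 1) / 2 is not a multiple of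
      \<open>D\<close>, but its double is. Squaring gives roots of order \<open>2 * D\<close>, the
      half-integer phases.\<close>
    have "even (D * (D - 1))" using D by (cases D) auto
    then have "omega D ^ (?w * (D * (D - 1) div 2) * 2) = 1"
      unfolding omega_power_eq_1_iff[OF D] by (simp add: mult.assoc)
    then have "c ^ (D * 2) = ?c ^ 2"
      by (simp only: power_mult_distrib power_mult mult_1_right)
    then show ?thesis unfolding c using True
      by (simp add: pauli_phases_eq[OF D] phase_order_def mult.commute)
  next
    case False
    then obtain d where "D = 2 * d + 1" by (blast elim: oddE)
    then have "D * (D - 1) div 2 = D * d" by simp
    then have "omega D ^ (?w * (D * (D - 1) div 2)) = 1"
      by (simp add: omega_power_eq_1_iff[OF D])
    then show ?thesis using c False by (simp add: pauli_phases_eq[OF D] phase_order_def)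
  qed
qed

section \<open>Traces and the projector onto a stabilizer state\<close>

lemma card_basis: "finite Q \<Longrightarrow> card (basis D Q) = D ^ card Q"
proof -
  assume Q: "finite Q"
  have "bij_betw (\<lambda>k. restrict k Q) (basis D Q) (Q \<rightarrow>\<^sub>E {..<D})"
    by (rule bij_betwI[where g = "\<lambda>f i. if i \<in> Q then f i else 0"])
       (auto simp: basis_def fun_eq_iff PiE_def extensional_def)
  then show ?thesis by (simp add: bij_betw_same_card card_PiE Q)
qed

text \<open>A nontrivial X-part leaves no diagonal entries. Otherwise some z_i is not divisible by
  \<open>D\<close>, and translating the index by one at qudit \<open>i\<close> multiplies the
  diagonal sum by omega^(z_i), which is not 1.\<close>

lemma trace_pauli_op:
  assumes D: "D > 0" and Q: "finite Q"
    and ne: "\<And>c'. pauli_op D Q c x z \<noteq> op_scale c' (op_id D Q)"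
  shows "(\<Sum>k\<in>basis D Q. pauli_op D Q c x z k k) = 0"
proof (cases "\<forall>i\<in>Q. D dvd x i")
  case True
  then have fixed: "shift D Q x k = k" if "k \<in> basis D Q" for k
    using that by (intro shift_eq_self) auto
  have "\<not> (\<forall>i\<in>Q. D dvd z i)"
  proof
    assume "\<forall>i\<in>Q. D dvd z i"
    then have "pauli_op D Q c x z = pauli_op D Q c (\<lambda>_. 0) (\<lambda>_. 0)"
      using True by (intro pauli_op_cong[OF D]) (simp_all add: cong_0_iff)
    then show False
      using ne[of c] unfolding op_id_eq_pauli_op[OF D] by (metis pauli_op_scale)
  qed
  then obtain i where i: "i \<in> Q" "\<not> D dvd z i" by blast
  let ?e = "\<lambda>l. if l = i then 1 else 0 :: nat"
  let ?f = "\<lambda>k. omega D ^ (\<Sum>l\<in>Q. z l * k l)"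
  have "?f (shift D Q ?e k) = omega D ^ z i * ?f k" for k
  proof -
    have "?f (shift D Q ?e k) = omega D ^ (\<Sum>l\<in>Q. z l * (k l + ?e l))"
      by (rule omega_sum_cong) (auto simp: shift_def cong_def mod_simps)
    also have "(\<Sum>l\<in>Q. z l * (k l + ?e l)) = (\<Sum>l\<in>Q. z l * k l) + z i"
    proof -
      have "(\<Sum>l\<in>Q. z l * ?e l) = (\<Sum>l\<in>Q. if l = i then z l else 0)"
        by (rule sum.cong) auto
      also have "\<dots> = z i" using Q i(1) by simp
      finally have "(\<Sum>l\<in>Q. z l * ?e l) = z i" .
      then show ?thesis by (simp only: distrib_left sum.distrib)
    qed
    finally show ?thesis by (simp add: power_add mult.commute)
  qed
  then have "(\<Sum>k\<in>basis D Q. ?f k) = omega D ^ z i * (\<Sum>k\<in>basis D Q. ?f k)"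
    using sum.reindex_bij_betw[OF bij_betw_shift[OF D, of Q ?e], of ?f]
    by (simp add: sum_distrib_left)
  then have "(\<Sum>k\<in>basis D Q. ?f k) = 0"
    using i(2) omega_power_eq_1_iff[OF D, of "z i"] by simp
  moreover have "(\<Sum>k\<in>basis D Q. pauli_op D Q c x z k k) = c * (\<Sum>k\<in>basis D Q. ?f k)"
    unfolding sum_distrib_left by (rule sum.cong) (simp_all add: pauli_op_eq[OF D] fixed)
  ultimately show ?thesis by simp
next
  case False
  then obtain i where i: "i \<in> Q" "\<not> D dvd x i" by blast
  have "k \<noteq> shift D Q x k" if "k \<in> basis D Q" for k
  proof
    assume "k = shift D Q x k"
    then have "k i = shift D Q x k i" by (rule fun_cong)
    then have "k i = (k i + x i) mod D" using i(1) by (simp add: shift_def)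
    moreover have "k i < D" using that i(1) by (simp add: basis_def)
    ultimately have "[k i + x i = k i + 0] (mod D)" by (simp add: cong_def)
    then show False using i(2) by (simp only: cong_add_lcancel_nat cong_0_iff)
  qed
  then show ?thesis by (intro sum.neutral) (auto simp: pauli_op_eq[OF D])
qed

lemma trace_group:
  assumes D: "D > 0" and Q: "finite Q" and S: "op_group D Q S" and fin: "finite S"
    and P: "\<And>s. s \<in> S \<Longrightarrow> \<exists>c x z. s = pauli_op D Q c x z"
  shows "(\<Sum>s\<in>S. \<Sum>k\<in>basis D Q. s k k) = of_nat (D ^ card Q)"
proof -
  have tr: "(\<Sum>k\<in>basis D Q. s k k) = (if s = op_id D Q then of_nat (D ^ card Q) else 0)"
    if s: "s \<in> S" for s
  proof (cases "s = op_id D Q")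
    case True
    have "(\<Sum>k\<in>basis D Q. op_id D Q k k) = (\<Sum>k\<in>basis D Q. 1)"
      by (rule sum.cong) (auto simp: op_id_def)
    then show ?thesis using True by (simp add: card_basis[OF Q])
  next
    case False
    obtain c x z where s': "s = pauli_op D Q c x z" using P[OF s] by blast
    have "(\<Sum>k\<in>basis D Q. pauli_op D Q c x z k k) = 0"
      using op_groupD(6)[OF S] s False unfolding s' by (intro trace_pauli_op[OF D Q]) metis
    then show ?thesis using False s' by simp
  qed
  show ?thesis
    using fin op_groupD(2)[OF S] by (simp add: tr cong: sum.cong)
qed

lemma stabilizer_state_norm:
  assumes D: "D > 0" and Q: "finite Q" and S: "op_group D Q S" and fin: "finite S"
    and P: "\<And>s. s \<in> S \<Longrightarrow> \<exists>c x z. s = pauli_op D Q c x z"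
    and \<psi>: "is_stabilizer_state D Q S \<psi>"
  shows "(\<Sum>k\<in>basis D Q. \<psi> k * cnj (\<psi> k)) = 1"
proof -
  have "(\<Sum>k\<in>basis D Q. \<psi> k * cnj (\<psi> k)) =
      (\<Sum>k\<in>basis D Q. \<Sum>s\<in>S. s k k) / of_nat D ^ card Q"
    using \<psi> unfolding is_stabilizer_state_def sum_divide_distrib by (intro sum.cong) auto
  also have "\<dots> = 1"
    using trace_group[OF D Q S fin P] D by (subst sum.swap) simp
  finally show ?thesis .
qed

lemma stabilizer_state_nonzero:
  assumes "D > 0" "finite Q" "op_group D Q S" "finite S"
    and "\<And>s. s \<in> S \<Longrightarrow> \<exists>c x z. s = pauli_op D Q c x z"
    and "is_stabilizer_state D Q S \<psi>"
  obtains j where "j \<in> basis D Q" "\<psi> j \<noteq> 0"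
proof -
  have "\<not> (\<forall>j\<in>basis D Q. \<psi> j = 0)"
  proof
    assume "\<forall>j\<in>basis D Q. \<psi> j = 0"
    then have "(\<Sum>k\<in>basis D Q. \<psi> k * cnj (\<psi> k)) = 0" by simp
    then show False using stabilizer_state_norm[OF assms] by simp
  qed
  then show ?thesis using that by blast
qed

text \<open>A column of the projector at an index where \<open>\<psi>\<close> is nonzero is a
  nonzero multiple of \<open>\<psi>\<close>. Left multiplication by \<open>s\<close> merely permutes
  the summands of that column.\<close>

lemma apply_op_stabilizer_state:
  assumes D: "D > 0" and Q: "finite Q" and S: "op_group D Q S" and fin: "finite S"
    and P: "\<And>s. s \<in> S \<Longrightarrow> \<exists>c x z. s = pauli_op D Q c x z"
    and \<psi>: "is_stabilizer_state D Q S \<psi>" and s: "s \<in> S" and k: "k \<in> basis D Q"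
  shows "apply_op D Q s \<psi> k = \<psi> k"
proof -
  obtain j where j: "j \<in> basis D Q" "\<psi> j \<noteq> 0"
    using stabilizer_state_nonzero[OF D Q S fin P \<psi>] .
  have \<psi>': "\<psi> k * cnj (\<psi> j) = (\<Sum>s\<in>S. s k j) / of_nat D ^ card Q" if "k \<in> basis D Q" for k
    using \<psi> j that by (simp add: is_stabilizer_state_def)
  have "apply_op D Q s \<psi> k * cnj (\<psi> j) = (\<Sum>l\<in>basis D Q. s k l * (\<Sum>t\<in>S. t l j)) / of_nat D ^ card Q"
    unfolding apply_op_def sum_distrib_right sum_divide_distrib
    by (rule sum.cong) (simp_all add: mult.assoc \<psi>')
  also have "(\<Sum>l\<in>basis D Q. s k l * (\<Sum>t\<in>S. t l j)) = (\<Sum>t\<in>S. op_mult D Q s t k j)"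
    unfolding op_mult_def sum_distrib_left by (rule sum.swap)
  also have "\<dots> = (\<Sum>t\<in>S. t k j)"
    by (rule sum.reindex_bij_betw[OF bij_betw_left_mult[OF Q S s], of "\<lambda>t. t k j"])
  also have "\<dots> / of_nat D ^ card Q = \<psi> k * cnj (\<psi> j)" by (simp add: \<psi>'[OF k])
  finally show ?thesis using j by simp
qed

section \<open>Conjugation of groups and states by a unitary\<close>

definition op_conj :: "nat \<Rightarrow> nat set \<Rightarrow> qop \<Rightarrow> qop \<Rightarrow> qop" where
  "op_conj D Q V s = op_mult D Q (op_mult D Q V s) (op_adj V)"

lemma op_conj_inverse:
  assumes "finite Q" "unitary_op D Q V" "supported D Q s"
  shows "op_conj D Q (op_adj V) (op_conj D Q V s) = s"
proof -
  let ?m = "op_mult D Q"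
  have "op_conj D Q (op_adj V) (op_conj D Q V s) = ?m (?m (?m (op_adj V) V) s) (?m (op_adj V) V)"
    by (simp add: op_conj_def op_mult_assoc op_adj_adj)
  then show ?thesis
    using assms by (simp add: unitary_op_def op_mult_id_left op_mult_id_right)
qed

lemma op_conj_mult:
  assumes "finite Q" "unitary_op D Q V" "supported D Q b"
  shows "op_mult D Q (op_conj D Q V a) (op_conj D Q V b) = op_conj D Q V (op_mult D Q a b)"
proof -
  let ?m = "op_mult D Q"
  have "?m (op_conj D Q V a) (op_conj D Q V b) = ?m (?m V a) (?m (?m (?m (op_adj V) V) b) (op_adj V))"
    by (simp add: op_conj_def op_mult_assoc)
  then show ?thesis
    using assms by (simp add: op_conj_def unitary_op_def op_mult_id_left) (simp add: op_mult_assoc)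
qed

lemma op_conj_id:
  assumes "finite Q" "unitary_op D Q V"
  shows "op_conj D Q V (op_id D Q) = op_id D Q"
  using assms supported_unitary[OF assms(2)]
  by (simp add: op_conj_def op_mult_id_right unitary_op_def)

lemma op_group_conj:
  assumes Q: "finite Q" and V: "unitary_op D Q V" and S: "op_group D Q S"
  shows "op_group D Q (op_conj D Q V ` S)"
  unfolding op_group_def
proof (intro conjI ballI impI)
  note G = op_groupD[OF S]
  let ?c = "op_conj D Q V"
  have mult: "op_mult D Q (?c a) (?c b) = ?c (op_mult D Q a b)" if "b \<in> S" for a b
    using op_conj_mult[OF Q V G(1)[OF that]] .
  show "supported D Q s" if "s \<in> ?c ` S" for s
    using that G(1) supported_unitary[OF V]
    by (auto simp: op_conj_def intro!: supported_op_mult supported_op_adj)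
  show "op_id D Q \<in> ?c ` S"
    using op_conj_id[OF Q V] G(2) by (metis imageI)
  show "op_mult D Q a b \<in> ?c ` S" if "a \<in> ?c ` S" "b \<in> ?c ` S" for a b
    using that mult G(3) by auto
  show "\<exists>b\<in>?c ` S. op_mult D Q a b = op_id D Q" if a: "a \<in> ?c ` S" for a
  proof -
    obtain a' where a': "a' \<in> S" "a = ?c a'" using a by blast
    obtain b' where b': "b' \<in> S" "op_mult D Q a' b' = op_id D Q" using G(4)[OF a'(1)] by blast
    then show ?thesis using mult[OF b'(1), of a'] a' op_conj_id[OF Q V] by auto
  qed
  show "op_mult D Q a b = op_mult D Q b a" if "a \<in> ?c ` S" "b \<in> ?c ` S" for a b
    using that mult G(5) by auto
  show "s = op_id D Q" if s0: "s \<in> ?c ` S" "\<exists>c. s = op_scale c (op_id D Q)" for s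
  proof -
    obtain s' c where s: "s' \<in> S" "s = ?c s'" "s = op_scale c (op_id D Q)" using s0 by blast
    have V': "unitary_op D Q (op_adj V)"
      using V supported_op_adj[OF supported_unitary[OF V]]
      by (simp add: unitary_op_def op_adj_adj supported_def)
    \<comment> \<open>Conjugating back turns a scalar of the image into the same scalar inside
      \<open>S\<close>.\<close>
    have "s' = op_conj D Q (op_adj V) (op_scale c (op_id D Q))"
      using op_conj_inverse[OF Q V G(1)[OF s(1)]] s by simp
    also have "\<dots> = op_scale c (op_conj D Q (op_adj V) (op_id D Q))"
      by (simp add: op_conj_def op_scale_mult_left op_scale_mult_right)
    also have "\<dots> = op_scale c (op_id D Q)" by (simp add: op_conj_id[OF Q V'])
    finally have "s' = op_id D Q" using s(1) G(6) by auto
    then show ?thesis using s op_conj_id[OF Q V] by simp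
  qed
qed

lemma inj_on_op_conj:
  assumes "finite Q" "unitary_op D Q V" "op_group D Q S"
  shows "inj_on (op_conj D Q V) S"
  using op_conj_inverse[OF assms(1,2)] op_groupD(1)[OF assms(3)] by (metis inj_onI)

lemma stabilizer_state_conj:
  assumes Q: "finite Q" and V: "unitary_op D Q V" and S: "op_group D Q S"
    and \<psi>: "is_stabilizer_state D Q S \<psi>"
  shows "is_stabilizer_state D Q (op_conj D Q V ` S) (apply_op D Q V \<psi>)"
  unfolding is_stabilizer_state_def
proof (intro ballI)
  fix k j assume kj: "k \<in> basis D Q" "j \<in> basis D Q"
  let ?B = "basis D Q"
  have "apply_op D Q V \<psi> k * cnj (apply_op D Q V \<psi> j) =
      (\<Sum>a\<in>?B. \<Sum>b\<in>?B. V k a * (\<psi> a * cnj (\<psi> b)) * cnj (V j b))"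
    unfolding apply_op_def cnj_sum sum_product by (simp add: mult_ac)
  also have "\<dots> = (\<Sum>a\<in>?B. \<Sum>b\<in>?B. V k a * (\<Sum>s\<in>S. s a b) * cnj (V j b)) / of_nat D ^ card Q"
    unfolding sum_divide_distrib using \<psi>
    by (intro sum.cong refl) (auto simp: is_stabilizer_state_def)
  also have "(\<Sum>a\<in>?B. \<Sum>b\<in>?B. V k a * (\<Sum>s\<in>S. s a b) * cnj (V j b)) =
      (\<Sum>a\<in>?B. \<Sum>b\<in>?B. \<Sum>s\<in>S. V k a * s a b * cnj (V j b))"
    by (simp add: sum_distrib_left sum_distrib_right)
  also have "\<dots> = (\<Sum>a\<in>?B. \<Sum>s\<in>S. \<Sum>b\<in>?B. V k a * s a b * cnj (V j b))"
    by (intro sum.cong refl sum.swap)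
  also have "\<dots> = (\<Sum>s\<in>S. \<Sum>a\<in>?B. \<Sum>b\<in>?B. V k a * s a b * cnj (V j b))"
    by (rule sum.swap)
  also have "\<dots> = (\<Sum>s\<in>S. op_conj D Q V s k j)"
  proof (intro sum.cong refl)
    fix s
    have "op_conj D Q V s k j = (\<Sum>b\<in>?B. \<Sum>a\<in>?B. V k a * s a b * cnj (V j b))"
      by (simp add: op_conj_def op_mult_def op_adj_def sum_distrib_right)
    also have "\<dots> = (\<Sum>a\<in>?B. \<Sum>b\<in>?B. V k a * s a b * cnj (V j b))" by (rule sum.swap)
    finally show "(\<Sum>a\<in>?B. \<Sum>b\<in>?B. V k a * s a b * cnj (V j b)) = op_conj D Q V s k j" ..
  qed
  also have "\<dots> = (\<Sum>s\<in>op_conj D Q V ` S. s k j)"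
    by (simp add: sum.reindex[OF inj_on_op_conj[OF Q V S]])
  finally show "apply_op D Q V \<psi> k * cnj (apply_op D Q V \<psi> j) =
    (\<Sum>s\<in>op_conj D Q V ` S. s k j) / of_nat D ^ card Q" .
qed

text \<open>X-exponents add under products, so their divisibility by \<open>p\<close> passes from
  generators to the whole group. The scalars stay arbitrary.\<close>

lemma conj_generated_pauli:
  assumes D: "D > 0" and Q: "finite Q" and V: "unitary_op D Q V"
    and g: "\<And>g. g \<in> G \<Longrightarrow> \<exists>c x z. op_conj D Q V g = pauli_op D Q c x z \<and> (\<forall>i\<in>Q. p dvd x i)"
    and sup: "\<And>s. s \<in> generated D Q G \<Longrightarrow> supported D Q s"
    and s: "s \<in> generated D Q G"
  shows "\<exists>c x z. op_conj D Q V s = pauli_op D Q c x z \<and> (\<forall>i\<in>Q. p dvd x i)"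
  using s
proof (induction rule: generated.induct)
  case gen_id
  have "op_conj D Q V (op_id D Q) = pauli_op D Q 1 (\<lambda>_. 0) (\<lambda>_. 0)"
    using op_conj_id[OF Q V] op_id_eq_pauli_op[OF D] by simp
  then show ?case by (intro exI[of _ 1] exI[of _ "\<lambda>_. 0"]) simp
next
  case (gen_mult g s)
  obtain c x z where 1: "op_conj D Q V g = pauli_op D Q c x z" "\<forall>i\<in>Q. p dvd x i"
    using g[OF gen_mult(1)] by blast
  obtain c' x' z' where 2: "op_conj D Q V s = pauli_op D Q c' x' z'" "\<forall>i\<in>Q. p dvd x' i"
    using gen_mult by blast
  have "op_conj D Q V (op_mult D Q g s) =
    pauli_op D Q (c * c' * omega D ^ (\<Sum>i\<in>Q. z i * x' i)) (\<lambda>i. x i + x' i) (\<lambda>i. z i + z' i)"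
    using op_conj_mult[OF Q V sup[OF gen_mult(2)], of g]
    by (simp add: 1 2 pauli_op_product[OF D Q])
  moreover have "\<forall>i\<in>Q. p dvd x i + x' i" using 1 2 by simp
  ultimately show ?case by blast
qed

section \<open>Restriction to basis states divisible by p\<close>

text \<open>The embedding of k as k tensor 0: under the identification of p k + l with the pair (k,
  l), the multiples of \<open>p\<close> are the labels with l = 0.\<close>

definition dilate :: "nat \<Rightarrow> idx \<Rightarrow> idx" where
  "dilate p k = (\<lambda>i. p * k i)"

definition restrict_op :: "nat \<Rightarrow> qop \<Rightarrow> qop" where
  "restrict_op p A = (\<lambda>k j. A (dilate p k) (dilate p j))"

lemma inj_dilate: "p > 0 \<Longrightarrow> inj (dilate p)"
  by (auto simp: inj_def dilate_def fun_eq_iff)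

lemma dilate_basis_iff: "p > 0 \<Longrightarrow> dilate p k \<in> basis (p * D) Q \<longleftrightarrow> k \<in> basis D Q"
  by (auto simp: dilate_def basis_def)

lemma dilate_image_basis:
  assumes p: "p > 0"
  shows "dilate p ` basis D Q = {j \<in> basis (p * D) Q. \<forall>i\<in>Q. p dvd j i}"
proof (intro set_eqI iffI)
  fix j assume "j \<in> dilate p ` basis D Q"
  then show "j \<in> {j \<in> basis (p * D) Q. \<forall>i\<in>Q. p dvd j i}"
    using dilate_basis_iff[OF p] by (auto simp: dilate_def)
next
  fix j assume j: "j \<in> {j \<in> basis (p * D) Q. \<forall>i\<in>Q. p dvd j i}"
  then have "p dvd j i" for i by (cases "i \<in> Q") (auto simp: basis_def)
  then have "j = dilate p (\<lambda>i. j i div p)" by (simp add: dilate_def)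
  then show "j \<in> dilate p ` basis D Q"
    using j dilate_basis_iff[OF p, of "\<lambda>i. j i div p" D Q] by auto
qed

lemma omega_root: "p > 0 \<Longrightarrow> omega (p * D) ^ p = omega D"
  by (simp add: omega_def DeMoivre)

lemma dilate_shift:
  assumes "\<forall>i\<in>Q. p dvd x i"
  shows "shift (p * D) Q x (dilate p j) = dilate p (shift D Q (\<lambda>i. x i div p) j)"
proof
  fix i
  show "shift (p * D) Q x (dilate p j) i = dilate p (shift D Q (\<lambda>i. x i div p) j) i"
  proof (cases "i \<in> Q")
    case True
    then obtain y where "x i = p * y" using assms by blast
    then show ?thesis
      using True by (cases "p = 0") (simp_all add: shift_def dilate_def flip: distrib_left)
  qed (simp add: shift_def dilate_def)
qed

text \<open>On the labels p k, X^p is the elementary shift of dimension \<open>D\<close>, and Z acts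
  through the \<open>p\<close>-th power of \<open>omega (p * D)\<close>, which is
  \<open>omega D\<close>. The scalar carries over unchanged, so its admissibility in dimension
  \<open>D\<close> needs an argument of its own.\<close>

lemma restrict_pauli_op:
  assumes p: "p > 0" and D: "D > 0" and x: "\<forall>i\<in>Q. p dvd x i"
  shows "restrict_op p (pauli_op (p * D) Q c x z) = pauli_op D Q c (\<lambda>i. x i div p) z"
proof (intro ext)
  fix k j
  have pD: "p * D > 0" using p D by simp
  have "(\<Sum>i\<in>Q. z i * dilate p j i) = p * (\<Sum>i\<in>Q. z i * j i)"
    by (simp add: dilate_def sum_distrib_left mult_ac)
  then have 1: "omega (p * D) ^ (\<Sum>i\<in>Q. z i * dilate p j i) = omega D ^ (\<Sum>i\<in>Q. z i * j i)"
    by (simp add: power_mult omega_root[OF p])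
  have 2: "dilate p k = dilate p l \<longleftrightarrow> k = l" for l
    using inj_dilate[OF p] by (auto simp: inj_def)
  show "restrict_op p (pauli_op (p * D) Q c x z) k j = pauli_op D Q c (\<lambda>i. x i div p) z k j"
    by (simp add: restrict_op_def pauli_op_eq[OF pD] pauli_op_eq[OF D] dilate_basis_iff[OF p]
        dilate_shift[OF x] 1 2)
qed

text \<open>Row \<open>p k\<close> of \<open>A\<close> vanishes off the multiples of \<open>p\<close>, so nothing is lost in the restricted sum.\<close>

lemma apply_restrict:
  assumes p: "p > 0" and Q: "finite Q"
    and A: "A = pauli_op (p * D) Q c x z" and x: "\<forall>i\<in>Q. p dvd x i"
    and k: "k \<in> basis D Q"
  shows "(\<Sum>l\<in>basis D Q. A (dilate p k) (dilate p l) * v (dilate p l)) =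
    (\<Sum>l\<in>basis (p * D) Q. A (dilate p k) l * v l)"
proof -
  have zero: "A (dilate p k) l = 0" if l: "l \<in> basis (p * D) Q - dilate p ` basis D Q" for l
  proof -
    obtain i where i: "i \<in> Q" "\<not> p dvd l i"
      using l dilate_image_basis[OF p, of D Q] by auto
    have "p dvd (l i + x i) mod (p * D) \<longleftrightarrow> p dvd l i + x i"
      by (rule dvd_mod_iff) simp
    then have "p * k i \<noteq> (l i + x i) mod (p * D)"
      using i x by (metis dvd_add_left_iff dvd_triv_left)
    then show ?thesis using i unfolding A pauli_op_def by (auto simp: dilate_def)
  qed
  have "(\<Sum>l\<in>basis (p * D) Q. A (dilate p k) l * v l) =
      (\<Sum>l\<in>dilate p ` basis D Q. A (dilate p k) l * v l)"
    using zero dilate_image_basis[OF p, of D Q]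
    by (intro sum.mono_neutral_right finite_basis Q) auto
  also have "\<dots> = (\<Sum>l\<in>basis D Q. A (dilate p k) (dilate p l) * v (dilate p l))"
    by (subst sum.reindex[OF inj_on_subset[OF inj_dilate[OF p]]]) simp_all
  finally show ?thesis ..
qed

text \<open>Compression is a homomorphism on \<open>S\<close> because these operators preserve the
  span of the labels divisible by \<open>p\<close>. The restricted state keeps norm 1 and is fixed
  by the image; this excludes nontrivial scalars there and determines the order of the
  kernel.\<close>

lemma restrict_stabilizer_state:
  assumes p: "p > 0" and D: "D > 0" and Q: "finite Q"
    and S: "op_group (p * D) Q S" and fin: "finite S" and card: "card S = (p * D) ^ card Q"
    and P: "\<And>s. s \<in> S \<Longrightarrow> \<exists>c x z. s = pauli_op (p * D) Q c x z \<and> (\<forall>i\<in>Q. p dvd x i)"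
    and \<psi>: "is_stabilizer_state (p * D) Q S \<psi>"
    and supp: "\<And>j. j \<in> basis (p * D) Q \<Longrightarrow> \<psi> j \<noteq> 0 \<Longrightarrow> \<forall>i\<in>Q. p dvd j i"
  shows "pure_stabilizer_group D Q (restrict_op p ` S)"
    and "is_stabilizer_state D Q (restrict_op p ` S) (\<lambda>k. \<psi> (dilate p k))"
proof -
  note G = op_groupD[OF S]
  let ?E = "p * D" and ?r = "restrict_op p" and ?\<phi> = "\<lambda>k. \<psi> (dilate p k)"
  have E: "?E > 0" using p D by simp
  have P': "\<exists>c x z. s = pauli_op ?E Q c x z" if "s \<in> S" for s using P[OF that] by blast
  have rP: "\<exists>c x z. ?r s = pauli_op D Q c x z" if s: "s \<in> S" for s
    using P[OF s] restrict_pauli_op[OF p D] by blast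
  have rsup: "supported D Q (?r s)" if "s \<in> S" for s
    using rP[OF that] supported_pauli_op by metis
  have app: "apply_op D Q (?r s) (\<lambda>k. v (dilate p k)) k = apply_op ?E Q s v (dilate p k)"
    if s: "s \<in> S" and k: "k \<in> basis D Q" for s v k
    using P[OF s] apply_restrict[OF p Q _ _ k] unfolding apply_op_def restrict_op_def by blast
  have rmult: "op_mult D Q (?r a) (?r b) = ?r (op_mult ?E Q a b)" if a: "a \<in> S" and b: "b \<in> S" for a b
  proof (rule op_ext[of D Q])
    show "supported D Q (op_mult D Q (?r a) (?r b))" "supported D Q (?r (op_mult ?E Q a b))"
      by (intro supported_op_mult rsup G(3) a b)+
    fix k j assume k: "k \<in> basis D Q"
    show "op_mult D Q (?r a) (?r b) k j = ?r (op_mult ?E Q a b) k j"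
      using app[OF a k, of "\<lambda>l. b l (dilate p j)"]
      by (simp add: apply_op_def op_mult_def restrict_op_def)
  qed
  have rid: "?r (op_id ?E Q) = op_id D Q"
    by (simp add: op_id_eq_pauli_op[OF E] op_id_eq_pauli_op[OF D] restrict_pauli_op[OF p D])
  have norm: "(\<Sum>k\<in>basis D Q. ?\<phi> k * cnj (?\<phi> k)) = 1"
  proof -
    have "(\<Sum>k\<in>basis D Q. ?\<phi> k * cnj (?\<phi> k)) = (\<Sum>k\<in>dilate p ` basis D Q. \<psi> k * cnj (\<psi> k))"
      by (subst sum.reindex[OF inj_on_subset[OF inj_dilate[OF p]]]) simp_all
    also have "\<dots> = (\<Sum>k\<in>basis ?E Q. \<psi> k * cnj (\<psi> k))"
      using supp dilate_image_basis[OF p, of D Q]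
      by (intro sum.mono_neutral_left finite_basis Q) auto
    finally show ?thesis using stabilizer_state_norm[OF E Q S fin P' \<psi>] by simp
  qed
  have stab: "apply_op D Q (?r s) ?\<phi> k = ?\<phi> k" if "s \<in> S" "k \<in> basis D Q" for s k
    using app[OF that, of \<psi>] that dilate_basis_iff[OF p, of k D Q]
      apply_op_stabilizer_state[OF E Q S fin P' \<psi>] by simp
  obtain j where j: "j \<in> basis D Q" "?\<phi> j \<noteq> 0"
  proof -
    have "\<not> (\<forall>j\<in>basis D Q. ?\<phi> j = 0)"
    proof
      assume "\<forall>j\<in>basis D Q. ?\<phi> j = 0"
      then have "(\<Sum>k\<in>basis D Q. ?\<phi> k * cnj (?\<phi> k)) = 0" by simp
      then show False using norm by simp
    qed
    then show ?thesis using that by blast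
  qed
  have group: "op_group D Q (?r ` S)"
    unfolding op_group_def
  proof (intro conjI ballI impI)
    show "supported D Q s" if "s \<in> ?r ` S" for s
      using that rsup by blast
    show "op_id D Q \<in> ?r ` S" using rid G(2) by (metis imageI)
    show "op_mult D Q a b \<in> ?r ` S" if "a \<in> ?r ` S" "b \<in> ?r ` S" for a b
      using that rmult G(3) by auto
    show "\<exists>b\<in>?r ` S. op_mult D Q a b = op_id D Q" if a: "a \<in> ?r ` S" for a
    proof -
      obtain a' where a': "a' \<in> S" "a = ?r a'" using a by blast
      obtain b' where b': "b' \<in> S" "op_mult ?E Q a' b' = op_id ?E Q" using G(4)[OF a'(1)] by blast
      then show ?thesis using rmult[OF a'(1) b'(1)] a' rid by auto
    qed
    show "op_mult D Q a b = op_mult D Q b a" if "a \<in> ?r ` S" "b \<in> ?r ` S" for a b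
      using that rmult G(5) by auto
    show "s = op_id D Q" if s0: "s \<in> ?r ` S" "\<exists>c. s = op_scale c (op_id D Q)" for s
    proof -
      obtain s' c where s: "s' \<in> S" "s = ?r s'" "s = op_scale c (op_id D Q)" using s0 by blast
      \<comment> \<open>The image fixes the restricted state, so comparing amplitudes at
        \<open>j\<close>, where it is nonzero, forces the scalar to be 1.\<close>
      have "?\<phi> j = (\<Sum>l\<in>basis D Q. op_scale c (op_id D Q) j l * ?\<phi> l)"
        using stab[OF s(1) j(1)] s by (simp add: apply_op_def)
      also have "\<dots> = (\<Sum>l\<in>basis D Q. if l = j then c * ?\<phi> j else 0)"
        by (rule sum.cong) (auto simp: op_scale_def op_id_def)
      also have "\<dots> = c * ?\<phi> j" using j finite_basis[OF Q] by simp
      finally have "c = 1" using j by simp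
      then show ?thesis using s(3) by (simp add: op_scale_1)
    qed
  qed
  have sub: "?r ` S \<subseteq> pauli_group D Q"
  proof
    fix t assume t: "t \<in> ?r ` S"
    then obtain c x z where "t = pauli_op D Q c x z" using rP by blast
    then show "t \<in> pauli_group D Q"
      using phase_of_group_element[OF D Q group] t pauli_op_in_group[OF D] by blast
  qed
  define K where "K = card {s \<in> S. ?r s = op_id D Q}"
  have fibre: "card {s \<in> S. ?r s = t} = K" if t: "t \<in> ?r ` S" for t
  proof -
    obtain a where a: "a \<in> S" "t = ?r a" using t by blast
    obtain b where b: "b \<in> S" "op_mult ?E Q a b = op_id ?E Q" using G(4)[OF a(1)] by blast
    have ba: "op_mult ?E Q b a = op_id ?E Q" using G(5)[OF a(1) b(1)] b by simp
    note ra = rsup[OF a(1)]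
    \<comment> \<open>Every fibre is a coset of the kernel.\<close>
    have "bij_betw (op_mult ?E Q a) {s \<in> S. ?r s = op_id D Q} {s \<in> S. ?r s = t}"
    proof (rule bij_betwI[where g = "op_mult ?E Q b"])
      show "op_mult ?E Q a \<in> {s \<in> S. ?r s = op_id D Q} \<rightarrow> {s \<in> S. ?r s = t}"
        using G(3) a ra rmult[OF a(1), symmetric] op_mult_id_right[OF Q ra] by auto
      show "op_mult ?E Q b \<in> {s \<in> S. ?r s = t} \<rightarrow> {s \<in> S. ?r s = op_id D Q}"
        using G(3) b a rmult[OF b(1), symmetric] rmult[OF b(1) a(1)] ba rid by auto
    qed (use G(1) b ba in \<open>simp_all add: op_mult_assoc[symmetric] op_mult_id_left[OF Q]\<close>)
    then show ?thesis by (simp add: K_def bij_betw_same_card)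
  qed
  have sum_restrict: "(\<Sum>s\<in>S. h (?r s)) = of_nat K * (\<Sum>t\<in>?r ` S. h t)" for h :: "qop \<Rightarrow> complex"
  proof -
    have "(\<Sum>s\<in>S. h (?r s)) = (\<Sum>t\<in>?r ` S. \<Sum>s\<in>{s \<in> S. ?r s = t}. h (?r s))"
      by (rule sum.image_gen[OF fin])
    also have "\<dots> = (\<Sum>t\<in>?r ` S. of_nat K * h t)"
      using fibre by (intro sum.cong refl) simp
    finally show ?thesis by (simp add: sum_distrib_left)
  qed
  have \<phi>: "?\<phi> k * cnj (?\<phi> j) = of_nat K * (\<Sum>t\<in>?r ` S. t k j) / of_nat ?E ^ card Q"
    if "k \<in> basis D Q" "j \<in> basis D Q" for k j
    using \<psi> that dilate_basis_iff[OF p, of _ D Q] sum_restrict[of "\<lambda>s. s k j", symmetric]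
    by (simp add: is_stabilizer_state_def restrict_op_def)
  \<comment> \<open>Taking traces: the left side is the squared norm of the restricted state, and on
    the right only the identity of the image contributes. This yields the order \<open>K\<close> of
    the kernel without describing its elements.\<close>
  have "1 = (\<Sum>k\<in>basis D Q. of_nat K * (\<Sum>t\<in>?r ` S. t k k) / of_nat ?E ^ card Q)"
    unfolding norm[symmetric] by (rule sum.cong) (simp_all only: \<phi>)
  also have "\<dots> = of_nat K * (\<Sum>t\<in>?r ` S. \<Sum>k\<in>basis D Q. t k k) / of_nat ?E ^ card Q"
    by (subst sum.swap) (simp add: sum_distrib_left sum_divide_distrib)
  also have "(\<Sum>t\<in>?r ` S. \<Sum>k\<in>basis D Q. t k k) = of_nat (D ^ card Q)"
    by (rule trace_group[OF D Q group]) (use fin rP in auto)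
  finally have "of_nat ?E ^ card Q = of_nat K * (of_nat (D ^ card Q) :: complex)"
    using E by (simp add: field_simps)
  then have "?E ^ card Q = K * D ^ card Q"
    by (metis of_nat_eq_iff of_nat_mult of_nat_power)
  then have K: "K = p ^ card Q" using D by (simp add: power_mult_distrib)
  have "of_nat (card S) = (of_nat K * of_nat (card (?r ` S)) :: complex)"
    using sum_restrict[of "\<lambda>_. 1"] by simp
  then have "card S = K * card (?r ` S)"
    by (metis of_nat_eq_iff of_nat_mult)
  then have "card (?r ` S) = D ^ card Q" using card p by (simp add: K power_mult_distrib)
  then show "pure_stabilizer_group D Q (?r ` S)"
    using group sub fin by (simp add: pure_stabilizer_group_def stabilizer_group_iff)
  show "is_stabilizer_state D Q (?r ` S) ?\<phi>"
    unfolding is_stabilizer_state_def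
    using p by (simp add: \<phi> K power_mult_distrib)
qed

section \<open>The local reduction\<close>

text \<open>A vector is viewed as a matrix with all columns equal, so the laws of
  \<open>op_mult\<close> carry over to states; the column \<open>j\<close> is arbitrary.\<close>

lemma apply_op_eq_op_mult: "apply_op D Q A v k = op_mult D Q A (\<lambda>l _. v l) k j"
  by (simp add: apply_op_def op_mult_def)

lemma apply_op_mult: "apply_op D Q (op_mult D Q A B) v = apply_op D Q A (apply_op D Q B v)"
proof
  fix k
  have "apply_op D Q (op_mult D Q A B) v k = op_mult D Q A (op_mult D Q B (\<lambda>l _. v l)) k k"
    by (simp only: apply_op_eq_op_mult[of _ _ _ _ _ k] op_mult_assoc)
  also have "op_mult D Q B (\<lambda>l _. v l) = (\<lambda>l _. apply_op D Q B v l)"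
    by (simp add: op_mult_def apply_op_def)
  finally show "apply_op D Q (op_mult D Q A B) v k = apply_op D Q A (apply_op D Q B v) k"
    by (simp only: apply_op_eq_op_mult[of _ _ A _ _ k])
qed

text \<open>The Pauli operator splits into factors, one per party, and each
  \<open>U \<alpha>\<close> transforms its own factor. The local factors get scalar 1, and
  \<open>c\<close> is pulled out in front by linearity.\<close>

lemma tensor_intertwine:
  assumes D: "D > 0" and Q: "finite Q" and m: "\<forall>i\<in>Q. party i < m"
    and U: "\<And>\<alpha>. \<alpha> < m \<Longrightarrow> clifford_map D (part Q party \<alpha>) (U \<alpha>) (f \<alpha>)"
    and x: "\<And>\<alpha> k. \<alpha> < m \<Longrightarrow> k \<in> part Q party \<alpha> \<Longrightarrow> p dvd fst (f \<alpha> (x, z)) k"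
  shows "\<exists>c' x' z'. op_conj D Q (tensor D Q m party U) (pauli_op D Q c x z) = pauli_op D Q c' x' z' \<and>
    (\<forall>i\<in>Q. p dvd x' i)"
proof -
  let ?T = "tensor D Q m party" and ?P = "\<lambda>\<alpha>. part Q party \<alpha>"
  have V: "unitary_op D Q (?T U)"
    using U by (intro unitary_tensor D Q m) (simp add: clifford_map_def)
  have "\<forall>\<alpha>. \<exists>b. \<alpha> < m \<longrightarrow> op_mult D (?P \<alpha>) (U \<alpha>) (pauli_op D (?P \<alpha>) 1 x z) =
      op_mult D (?P \<alpha>) (pauli_op D (?P \<alpha>) b (fst (f \<alpha> (x, z))) (snd (f \<alpha> (x, z)))) (U \<alpha>)"
    using U unfolding clifford_map_def by blast
  from choice[OF this] obtain b where b: "\<And>\<alpha>. \<alpha> < m \<Longrightarrow>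
      op_mult D (?P \<alpha>) (U \<alpha>) (pauli_op D (?P \<alpha>) 1 x z) =
      op_mult D (?P \<alpha>) (pauli_op D (?P \<alpha>) (b \<alpha>) (fst (f \<alpha> (x, z))) (snd (f \<alpha> (x, z)))) (U \<alpha>)"
    by blast
  let ?x = "\<lambda>i. fst (f (party i) (x, z)) i" and ?z = "\<lambda>i. snd (f (party i) (x, z)) i"
  have "op_mult D Q (?T U) (pauli_op D Q 1 x z) =
      op_mult D Q (?T U) (?T (\<lambda>\<alpha>. pauli_op D (?P \<alpha>) 1 x z))"
    using tensor_pauli[OF D Q m, of "\<lambda>_. 1" "\<lambda>_. x" "\<lambda>_. z"] by simp
  also have "\<dots> = ?T (\<lambda>\<alpha>. op_mult D (?P \<alpha>) (pauli_op D (?P \<alpha>) (b \<alpha>) (fst (f \<alpha> (x, z)))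
      (snd (f \<alpha> (x, z)))) (U \<alpha>))"
    unfolding tensor_mult[OF Q m] by (rule tensor_cong) (rule b)
  also have "\<dots> = op_mult D Q (pauli_op D Q (\<Prod>\<alpha><m. b \<alpha>) ?x ?z) (?T U)"
    unfolding tensor_mult[OF Q m, symmetric] tensor_pauli[OF D Q m] ..
  finally have "op_mult D Q (?T U) (pauli_op D Q c x z) =
      op_mult D Q (op_scale c (pauli_op D Q (\<Prod>\<alpha><m. b \<alpha>) ?x ?z)) (?T U)"
    by (simp add: pauli_op_scale[of D Q c] op_scale_mult_left op_scale_mult_right)
  also have "op_scale c (pauli_op D Q (\<Prod>\<alpha><m. b \<alpha>) ?x ?z) = pauli_op D Q (c * (\<Prod>\<alpha><m. b \<alpha>)) ?x ?z"
    by (simp add: pauli_op_def op_scale_def fun_eq_iff)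
  finally have "op_conj D Q (?T U) (pauli_op D Q c x z) = pauli_op D Q (c * (\<Prod>\<alpha><m. b \<alpha>)) ?x ?z"
    unfolding op_conj_def by (rule conj_eq_of_intertwine[OF Q V supported_pauli_op])
  moreover have "\<forall>i\<in>Q. p dvd ?x i" using x m by simp
  ultimately show ?thesis by blast
qed

lemma support_class:
  assumes D: "D > 0" and pD: "p dvd D" and Q: "finite Q"
    and P: "\<And>s. s \<in> S \<Longrightarrow> \<exists>c x z. s = pauli_op D Q c x z \<and> (\<forall>i\<in>Q. p dvd x i)"
    and \<psi>: "is_stabilizer_state D Q S \<psi>"
    and kj: "k \<in> basis D Q" "j \<in> basis D Q" "\<psi> k \<noteq> 0" "\<psi> j \<noteq> 0" and i: "i \<in> Q"
  shows "[k i = j i] (mod p)"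
proof (rule ccontr)
  assume ne: "\<not> [k i = j i] (mod p)"
  have "s k j = 0" if s: "s \<in> S" for s
  proof -
    obtain c x z where s': "s = pauli_op D Q c x z" "\<forall>i\<in>Q. p dvd x i" using P[OF s] by blast
    have "k i \<noteq> (j i + x i) mod D"
    proof
      assume "k i = (j i + x i) mod D"
      then have "[k i = j i + x i] (mod D)" by (simp add: cong_def)
      then have "[k i = j i + x i] (mod p)" using pD cong_dvd_modulus_nat by blast
      moreover have "[j i + x i = j i + 0] (mod p)"
        using s'(2) i by (intro cong_add) (simp_all add: cong_0_iff)
      ultimately show False using ne cong_trans by fastforce
    qed
    then show ?thesis using i by (auto simp: s' pauli_op_def)
  qed
  then have "(\<Sum>s\<in>S. s k j) = 0" by (rule sum.neutral[rule_format])
  then have "\<psi> k * cnj (\<psi> j) = 0"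
    using \<psi> kj(1,2) by (simp add: is_stabilizer_state_def)
  then show False using kj by simp
qed

lemma local_reduction:
  fixes gc :: "nat \<Rightarrow> complex"
  assumes p: "prime p" and D': "D' > 0" and D: "D = p * D'" and Q: "finite Q"
    and m: "\<forall>i\<in>Q. party i < m"
    and S: "pure_stabilizer_group D Q S"
    and gen: "S = generated D Q {pauli_op D Q (gc a) (gx a) (gz a) | a. a < Ng}"
    and \<psi>: "is_stabilizer_state D Q S \<psi>"
    and iso: "\<And>\<alpha> a b. \<alpha> < m \<Longrightarrow> a < Ng \<Longrightarrow> b < Ng \<Longrightarrow>
      int p dvd symp_form (part Q party \<alpha>) (gx a, gz a) (gx b, gz b)"
  shows "\<exists>U. (\<forall>\<alpha><m. clifford D (part Q party \<alpha>) (U \<alpha>)) \<and>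
    (\<exists>S' \<phi>. pure_stabilizer_group D' Q S' \<and> is_stabilizer_state D' Q S' \<phi> \<and>
      (\<forall>j\<in>basis D Q. apply_op D Q (tensor D Q m party U) \<psi> j =
        (if \<forall>i\<in>Q. j i mod p = 0 then \<phi> (\<lambda>i. j i div p) else 0)))"
proof -
  let ?T = "tensor D Q m party" and ?P = "\<lambda>\<alpha>. part Q party \<alpha>"
  have p0: "p > 0" by (rule prime_gt_0_nat[OF p])
  have D0: "D > 0" using p0 D' by (simp add: D)
  have pD: "p dvd D" unfolding D by (rule dvd_triv_left)
  have grp: "op_group D Q S" and fin: "finite S" and card: "card S = D ^ card Q"
    using S unfolding pure_stabilizer_group_def stabilizer_group_iff by blast+
  have finP: "finite (?P \<alpha>)" for \<alpha> using Q by simp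
  let ?good = "\<lambda>U f. \<forall>\<alpha><m. clifford_map D (?P \<alpha>) (U \<alpha>) (f \<alpha>) \<and>
    (\<forall>a<Ng. \<forall>k\<in>?P \<alpha>. p dvd fst (f \<alpha> (gx a, gz a)) k)"
  have "\<exists>U f. clifford_map D (?P \<alpha>) U f \<and> (\<forall>a<Ng. \<forall>k\<in>?P \<alpha>. p dvd fst (f (gx a, gz a)) k)"
    if "\<alpha> < m" for \<alpha>
    using isotropic_to_Z_type[OF p pD D0 finP, of "{(gx a, gz a) | a. a < Ng}" \<alpha>] iso[OF that]
    by blast
  \<comment> \<open>Gate and exponent map are paired so that a single choice over the parties
    provides both.\<close>
  then have "\<forall>\<alpha>. \<exists>g. \<alpha> < m \<longrightarrow> clifford_map D (?P \<alpha>) (fst g) (snd g) \<and>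
    (\<forall>a<Ng. \<forall>k\<in>?P \<alpha>. p dvd fst (snd g (gx a, gz a)) k)"
    by auto
  from choice[OF this] obtain g where g: "?good (\<lambda>\<alpha>. fst (g \<alpha>)) (\<lambda>\<alpha>. snd (g \<alpha>))"
    by blast
  define U f where "U = (\<lambda>\<alpha>. fst (g \<alpha>))" and "f = (\<lambda>\<alpha>. snd (g \<alpha>))"
  have Uf: "?good U f" unfolding U_def f_def by (rule g)
  have unitary: "unitary_op D Q (?T V)" if "?good V f" for V
    using that by (intro unitary_tensor D0 Q m) (simp add: clifford_map_def)
  have paulis: "\<exists>c x z. s = pauli_op D Q c x z \<and> (\<forall>i\<in>Q. p dvd x i)"
    if V: "?good V f" and s: "s \<in> op_conj D Q (?T V) ` S" for V s
  proof -
    obtain s' where s': "s' \<in> S" "s = op_conj D Q (?T V) s'" using s by blast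
    have "\<exists>c x z. op_conj D Q (?T V) s' = pauli_op D Q c x z \<and> (\<forall>i\<in>Q. p dvd x i)"
    proof (rule conj_generated_pauli[OF D0 Q unitary[OF V]])
      fix g assume "g \<in> {pauli_op D Q (gc a) (gx a) (gz a) | a. a < Ng}"
      then obtain a where a: "a < Ng" "g = pauli_op D Q (gc a) (gx a) (gz a)" by blast
      show "\<exists>c x z. op_conj D Q (?T V) g = pauli_op D Q c x z \<and> (\<forall>i\<in>Q. p dvd x i)"
        unfolding a(2) by (rule tensor_intertwine[OF D0 Q m, of V f]) (use V a(1) in auto)
    qed (use s'(1) op_groupD(1)[OF grp] in \<open>simp_all only: gen[symmetric]\<close>)
    then show ?thesis using s' by simp
  qed
  have state: "is_stabilizer_state D Q (op_conj D Q (?T V) ` S) (apply_op D Q (?T V) \<psi>)"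
    if "?good V f" for V
    by (rule stabilizer_state_conj[OF Q unitary[OF that] grp \<psi>])
  have group: "op_group D Q (op_conj D Q (?T V) ` S)" if "?good V f" for V
    by (rule op_group_conj[OF Q unitary[OF that] grp])
  \<comment> \<open>Any index with nonzero amplitude serves, since its residues modulo
    \<open>p\<close> determine the class that supports the state.\<close>
  obtain j0 where j0: "j0 \<in> basis D Q" "apply_op D Q (?T U) \<psi> j0 \<noteq> 0"
  proof (rule stabilizer_state_nonzero[OF D0 Q group[OF Uf] finite_imageI[OF fin] _ state[OF Uf]])
    show "\<exists>c x z. s = pauli_op D Q c x z" if "s \<in> op_conj D Q (?T U) ` S" for s
      using paulis[OF Uf that] by blast
  qed
  \<comment> \<open>The translation by \<open>D - j0 i\<close> takes \<open>j0\<close> to 0 and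
    hence the supporting class to the multiples of \<open>p\<close>. It is a product of local
    shifts, so each party can apply its share, and \<open>f\<close> stays the exponent map.\<close>
  define X where "X = (\<lambda>A. pauli_op D A 1 (\<lambda>i. D - j0 i) (\<lambda>_. 0))"
  define U' where "U' = (\<lambda>\<alpha>. op_mult D (?P \<alpha>) (X (?P \<alpha>)) (U \<alpha>))"
  have good': "?good U' f"
  proof (intro allI impI conjI ballI)
    fix \<alpha> assume "\<alpha> < m"
    then have "clifford_map D (?P \<alpha>) (U \<alpha>) (f \<alpha>)" using Uf by blast
    from clifford_map_comp[OF D0 finP clifford_map_pauli[OF D0 finP] this]
    show "clifford_map D (?P \<alpha>) (U' \<alpha>) (f \<alpha>)"
      unfolding U'_def X_def id_comp .
    show "p dvd fst (f \<alpha> (gx a, gz a)) k" if "a < Ng" "k \<in> ?P \<alpha>" for a k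
      using Uf \<open>\<alpha> < m\<close> that by blast
  qed
  let ?\<psi> = "apply_op D Q (?T U') \<psi>"
  have "?T (\<lambda>\<alpha>. X (?P \<alpha>)) = X Q"
    unfolding X_def using tensor_pauli[OF D0 Q m, of "\<lambda>_. 1" "\<lambda>_ i. D - j0 i" "\<lambda>_ _. 0"] by simp
  then have "?T U' = op_mult D Q (X Q) (?T U)"
    unfolding U'_def tensor_mult[OF Q m, symmetric] by simp
  then have "?\<psi> (shift D Q (\<lambda>i. D - j0 i) j0) =
      op_mult D Q (X Q) (\<lambda>l _. apply_op D Q (?T U) \<psi> l) (shift D Q (\<lambda>i. D - j0 i) j0) j0"
    by (simp only: apply_op_mult apply_op_eq_op_mult[of _ _ "X Q" _ _ j0])
  also have "\<dots> \<noteq> 0"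
    unfolding X_def pauli_op_mult[OF D0 Q j0(1)] using j0(2) by simp
  also have "shift D Q (\<lambda>i. D - j0 i) j0 = (\<lambda>_. 0)"
    using j0(1) by (auto simp: shift_def basis_def fun_eq_iff less_imp_le)
  finally have nz: "?\<psi> (\<lambda>_. 0) \<noteq> 0" .
  have b0: "(\<lambda>_. 0) \<in> basis D Q" using D0 by (simp add: basis_def)
  let ?S = "op_conj D Q (?T U') ` S"
  have supp: "\<forall>i\<in>Q. p dvd j i" if j: "j \<in> basis D Q" "?\<psi> j \<noteq> 0" for j
  proof
    fix i assume "i \<in> Q"
    \<comment> \<open>The index 0 now has nonzero amplitude, so comparing any index of the support
      with it gives divisibility by \<open>p\<close>.\<close>
    then have "[j i = 0] (mod p)"
      using support_class[where \<psi> = ?\<psi> and k = j and j = "\<lambda>_. 0" and i = i and S = ?S,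
          OF D0 pD Q paulis[OF good'] state[OF good'] j(1) b0 j(2) nz]
      by simp
    then show "p dvd j i" by (simp only: cong_0_iff)
  qed
  have cardS: "card ?S = D ^ card Q"
    using card card_image[OF inj_on_op_conj[OF Q unitary[OF good'] grp]] by simp
  note res = restrict_stabilizer_state[where p = p and D = D' and Q = Q and S = ?S and \<psi> = ?\<psi>,
      folded D, OF p0 D' Q group[OF good'] finite_imageI[OF fin] cardS]
  show ?thesis
  proof (intro exI conjI)
    show "\<forall>\<alpha><m. clifford D (?P \<alpha>) (U' \<alpha>)"
      using good' clifford_map_imp_clifford[OF D0 finP] by blast
    show "pure_stabilizer_group D' Q (restrict_op p ` ?S)"
      "is_stabilizer_state D' Q (restrict_op p ` ?S) (\<lambda>k. ?\<psi> (dilate p k))"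
      by (rule res, erule paulis[OF good'], rule state[OF good'], erule (1) supp)+
    show "\<forall>j\<in>basis D Q. ?\<psi> j =
      (if \<forall>i\<in>Q. j i mod p = 0 then ?\<psi> (dilate p (\<lambda>i. j i div p)) else 0)"
    proof
      fix j assume j: "j \<in> basis D Q"
      show "?\<psi> j = (if \<forall>i\<in>Q. j i mod p = 0 then ?\<psi> (dilate p (\<lambda>i. j i div p)) else 0)"
      proof (cases "\<forall>i\<in>Q. j i mod p = 0")
        case True
        then have "p dvd j i" for i using j by (cases "i \<in> Q") (auto simp: basis_def)
        then have "dilate p (\<lambda>i. j i div p) = j" by (simp add: dilate_def)
        then show ?thesis using True by simp
      next
        case False
        then obtain i where "i \<in> Q" "\<not> p dvd j i" by (auto simp: dvd_eq_mod_eq_0)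
        then have "?\<psi> j = 0" using supp[OF j] by blast
        then show ?thesis by (simp only: if_not_P[OF False])
      qed
    qed
  qed
qed

theorem theorem1:
  fixes p n D N m Ng :: nat
    and party :: "nat \<Rightarrow> nat"
    and S :: "qop set"
    and gc :: "nat \<Rightarrow> complex"
    and gx gz :: "nat \<Rightarrow> idx"
    and \<psi> :: qvec
  assumes "prime (p::nat)" and "n \<ge> 2" and "D = p ^ n"
    and "\<forall>i<N. party i < m"
    and "pure_stabilizer_group D {..<N} S"
    and "\<forall>a<Ng. \<forall>i<N. gx a i < D \<and> gz a i < D"
    and "S = generated D {..<N} {pauli_op D {..<N} (gc a) (gx a) (gz a) | a. a < Ng}"
    and "is_stabilizer_state D {..<N} S \<psi>"
    and "\<forall>\<alpha><m. \<forall>a<Ng. \<forall>b<Ng. int p dvd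
           (\<Sum>k\<in>{k. k < N \<and> party k = \<alpha>}.
              int (gx a k) * int (gz b k) - int (gz a k) * int (gx b k))"
  shows "\<exists>U :: nat \<Rightarrow> qop.
           (\<forall>\<alpha><m. clifford D {k. k < N \<and> party k = \<alpha>} (U \<alpha>)) \<and>
           (\<exists>S' \<phi>. pure_stabilizer_group (p ^ (n - 1)) {..<N} S' \<and>
              is_stabilizer_state (p ^ (n - 1)) {..<N} S' \<phi> \<and>
              (\<forall>j\<in>basis D {..<N}.
                 apply_op D {..<N} (local_tensor D {..<N} m (\<lambda>\<alpha>. {k. k < N \<and> party k = \<alpha>}) U) \<psi> j
                 = (if \<forall>i<N. j i mod p = 0 then \<phi> (\<lambda>i. j i div p) else 0)))"
proof -
  \<comment> \<open>The exponent is positive, so one factor \<open>p\<close> splits off; the rest is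
    the dimension of the remaining qudits.\<close>
  have D: "D = p * p ^ (n - 1)"
    using assms(2,3) by (cases n) auto
  have D': "p ^ (n - 1) > 0" using prime_gt_0_nat[OF assms(1)] by simp
  have ball: "(\<forall>i\<in>{..<N}. R i) \<longleftrightarrow> (\<forall>i<N. R i)" for R
    by auto
  show ?thesis
    by (rule local_reduction[OF assms(1) D' D, of "{..<N}" party m S gc gx gz Ng \<psi>,
          unfolded ball lessThan_iff symp_form_def fst_conv snd_conv])
      (use assms(4,5,7-9) in \<open>simp_all only: finite_lessThan\<close>)
qed

end
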